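(* Let $p:M\to B$ be a fibration and let $\Phi\in\Omega^3(M)$ be a closed $3$-form that fibres $2$-plectically over $B$, with vertical component $\Phi_V=\Phi|_{\wedge^3\mathcal V}$. Then: - $\Phi_V$ induces a $2$-plectic form on the fibres of $M\to B$; - the $2$-plectic fibration $(M\to B,\Phi_V)$ admits a $2$-plectic connection; - this connection has hamiltonian curvature.
   Context: All objects are smooth. A fibration $p:M\to B$ is a submersion admitting a complete Ehresmann connection. $\mathcal V=\ker dp$, $\mathcal V^0\subset T^*M$ is the annihilator of $\mathcal V$, $\Omega^q(\mathcal V)=\Gamma(\wedge^q\mathcal V^* )$, and $d_V$ is the vertical de Rham differential. An Ehresmann connection is a splitting $TM=\mathcal V\oplus\mathrm{Hor}$, with horizontal lift $h$ and curvature $C(u,v)=[h(u),h(v)]-h([u,v])$, $u,v\in\mathfrak X(B)$. A $3$-form $\Phi\in\Omega^3(M)$ is said to fibre $2$-plectically over $B$ if: (i) $\mathrm{Graph}(\Phi)\cap\big(\mathcal V\oplus(\wedge^2\mathcal V)^0\big)=\{0\}$, where $\Phi$ is regarded as the map $TM\to\wedge^2T^*M$, $X\mapsto i_X\Phi$, and $(\wedge^2\mathcal V)^0\subset\wedge^2T^*M$ is the annihilator of $\wedge^2\mathcal V$; and (ii) $\mathrm{Graph}(\Phi)\cap\big(\wedge^2\mathcal V\oplus\mathcal V^0\big)=\{0\}$, where $\Phi$ is regarded as the map $\wedge^2TM\to T^*M$, $b\mapsto i_b\Phi$. A $2$-plectic form is a closed $3$-form $\Phi$ with $i_X\Phi=0\Rightarrow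 X=0$ for all tangent vectors $X$. A fibration with $2$-plectic fibres is a fibration with $\Phi_V\in\Omega^3(\mathcal V)$ such that $d_V\Phi_V=0$ and $i_X\Phi_V=0\Rightarrow X=0$ for $X\in\mathcal V$. A $2$-plectic (or compatible) connection is an Ehresmann connection with $\mathcal L_{h(u)}\Phi_V=0$ for all $u\in\mathfrak X(B)$; a $2$-plectic fibration is a fibration with $2$-plectic fibres that admits such a connection. A $1$-form $\alpha$ is hamiltonian, with hamiltonian vector field $X$, if $-i_X\Phi=d\alpha$. The connection has hamiltonian curvature if there is $\omega\in\Omega^2(B,\Omega^1(\mathcal V))$ (a $2$-form on $B$ with values in vertical $1$-forms) with $-i_{C(u,v)}\Phi_V=d_V(\omega(u,v))$ for all $u,v\in\mathfrak X(B)$. *)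

theory Defs
  imports "HOL-Analysis.Analysis"
begin

section \<open>Smooth manifolds\<close>

text \<open>
  The points of a manifold are the elements of a topological type \<open>'m\<close>, and the manifold is given by
  a smooth atlas on it. The model space \<open>'e\<close> is a finite-dimensional real inner product space. The
  class \<open>euclidean_space\<close> is not used for it because it excludes dimension 0 (a base consisting of a
  point, or fibres of dimension 0).
\<close>

type_synonym ('m, 'e) chart = "'m set \<times> ('m \<Rightarrow> 'e)"
type_synonym ('m, 'e) atlas = "('m, 'e) chart set"

abbreviation chart_dom :: "('m, 'e) chart \<Rightarrow> 'm set"
  where "chart_dom c \<equiv> fst c"

abbreviation chart_map :: "('m, 'e) chart \<Rightarrow> 'm \<Rightarrow> 'e"
  where "chart_map c \<equiv> snd c"

definition chart_inv :: "('m, 'e) chart \<Rightarrow> 'e \<Rightarrow> 'm"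
  where "chart_inv c = inv_into (chart_dom c) (chart_map c)"

text \<open>
  On an open subset of a finite-dimensional space, \<open>differentiable_times k\<close> says that all iterated
  directional derivatives of order at most \<open>k\<close> exist and are continuous, i.e. \<open>f\<close> is of class C^k.
\<close>

fun differentiable_times ::
  "nat \<Rightarrow> 'e::real_normed_vector set \<Rightarrow> ('e \<Rightarrow> 'f::real_normed_vector) \<Rightarrow> bool"
where
  "differentiable_times 0 S f \<longleftrightarrow> continuous_on S f"
| "differentiable_times (Suc k) S f \<longleftrightarrow>
     (\<forall>z\<in>S. f differentiable (at z)) \<and>
     (\<forall>v. differentiable_times k S (\<lambda>z. frechet_derivative f (at z) v))"

definition smooth_on ::
  "'e::real_normed_vector set \<Rightarrow> ('e \<Rightarrow> 'f::real_normed_vector) \<Rightarrow> bool"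
  where "smooth_on S f \<longleftrightarrow> (\<forall>k. differentiable_times k S f)"

definition smooth_manifold :: "('m::{t2_space, second_countable_topology}, 'e::real_inner) atlas \<Rightarrow> bool"
where
  "smooth_manifold A \<longleftrightarrow>
     (\<exists>S::'e set. finite S \<and> span S = UNIV) \<and>
     (\<Union>c\<in>A. chart_dom c) = UNIV \<and>
     (\<forall>c\<in>A. open (chart_dom c) \<and> open (chart_map c ` chart_dom c) \<and>
        homeomorphism (chart_dom c) (chart_map c ` chart_dom c) (chart_map c) (chart_inv c)) \<and>
     (\<forall>c\<in>A. \<forall>d\<in>A. smooth_on (chart_map c ` (chart_dom c \<inter> chart_dom d))
        (chart_map d \<circ> chart_inv c))"

definition smooth_map ::
  "('m::topological_space, 'e::real_inner) atlas \<Rightarrow> ('n::topological_space, 'f::real_inner) atlas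
    \<Rightarrow> ('m \<Rightarrow> 'n) \<Rightarrow> bool"
where
  "smooth_map A B f \<longleftrightarrow>
     continuous_on UNIV f \<and>
     (\<forall>c\<in>A. \<forall>d\<in>B. smooth_on (chart_map c ` (chart_dom c \<inter> f -` chart_dom d))
        (chart_map d \<circ> f \<circ> chart_inv c))"

definition real_line :: "(real, real) atlas"
  where "real_line = {(UNIV, \<lambda>t. t)}"

definition smooth_fun_on ::
  "('m::topological_space, 'e::real_inner) atlas \<Rightarrow> 'm set \<Rightarrow> ('m \<Rightarrow> real) \<Rightarrow> bool"
where
  "smooth_fun_on A U f \<longleftrightarrow>
     (\<forall>c\<in>A. smooth_on (chart_map c ` (U \<inter> chart_dom c)) (f \<circ> chart_inv c))"


section \<open>Tangent vectors and vector fields\<close>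

text \<open>
  A chart \<open>chart_at A x\<close> around each point \<open>x\<close> is chosen once and for all. The tangent space at \<open>x\<close> is
  a copy of the model space \<open>'e\<close>: \<open>v :: 'e\<close> stands for the tangent vector at \<open>x\<close> whose coordinates in
  the chart \<open>chart_at A x\<close> are \<open>v\<close>. Since the chosen chart varies with the point, smoothness of
  vector fields has to be expressed through \<open>tangent_coords\<close>, the coordinates of the same tangent
  vector in an arbitrary chart.
\<close>

definition chart_at :: "('m, 'e) atlas \<Rightarrow> 'm \<Rightarrow> ('m, 'e) chart"
  where "chart_at A x = (SOME c. c \<in> A \<and> x \<in> chart_dom c)"

definition coord_at :: "('m, 'e) atlas \<Rightarrow> 'm \<Rightarrow> 'e"
  where "coord_at A x = chart_map (chart_at A x) x"

definition tangent_map ::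
  "('m, 'e::real_inner) atlas \<Rightarrow> ('n, 'f::real_inner) atlas \<Rightarrow> ('m \<Rightarrow> 'n) \<Rightarrow> 'm \<Rightarrow> 'e \<Rightarrow> 'f"
where
  "tangent_map A B f x =
     frechet_derivative (chart_map (chart_at B (f x)) \<circ> f \<circ> chart_inv (chart_at A x))
       (at (coord_at A x))"

definition tangent_coords ::
  "('m, 'e::real_inner) atlas \<Rightarrow> ('m, 'e) chart \<Rightarrow> 'm \<Rightarrow> 'e \<Rightarrow> 'e"
where
  "tangent_coords A c x =
     frechet_derivative (chart_map c \<circ> chart_inv (chart_at A x)) (at (coord_at A x))"

definition field_coords ::
  "('m, 'e::real_inner) atlas \<Rightarrow> ('m, 'e) chart \<Rightarrow> ('m \<Rightarrow> 'e) \<Rightarrow> 'e \<Rightarrow> 'e"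
  where "field_coords A c X z = tangent_coords A c (chart_inv c z) (X (chart_inv c z))"

definition smooth_field_on ::
  "('m::topological_space, 'e::real_inner) atlas \<Rightarrow> 'm set \<Rightarrow> ('m \<Rightarrow> 'e) \<Rightarrow> bool"
where
  "smooth_field_on A U X \<longleftrightarrow>
     (\<forall>c\<in>A. smooth_on (chart_map c ` (U \<inter> chart_dom c)) (field_coords A c X))"

text \<open>The derivative of the function \<open>f\<close> along the vector field \<open>X\<close>.\<close>

definition dir_deriv :: "('m, 'e::real_inner) atlas \<Rightarrow> ('m \<Rightarrow> 'e) \<Rightarrow> ('m \<Rightarrow> real) \<Rightarrow> 'm \<Rightarrow> real"
  where "dir_deriv A X f x = tangent_map A real_line f x (X x)"

text \<open>
  In coordinates \<open>[X, Y] = DY(X) - DX(Y)\<close>, so that \<open>[X, Y] f = X (Y f) - Y (X f)\<close>. The chart is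
  \<open>chart_at A x\<close>, hence the result represents a tangent vector at \<open>x\<close>.
\<close>

definition lie_bracket ::
  "('m, 'e::real_inner) atlas \<Rightarrow> ('m \<Rightarrow> 'e) \<Rightarrow> ('m \<Rightarrow> 'e) \<Rightarrow> 'm \<Rightarrow> 'e"
where
  "lie_bracket A X Y x =
     (let c = chart_at A x; z = coord_at A x in
        frechet_derivative (field_coords A c Y) (at z) (field_coords A c X z) -
        frechet_derivative (field_coords A c X) (at z) (field_coords A c Y z))"


section \<open>Subbundles of the tangent bundle, and forms on them\<close>

text \<open>A smooth subbundle has a smooth local frame around each point.\<close>

definition subbundle ::
  "('m::topological_space, 'e::real_inner) atlas \<Rightarrow> ('m \<Rightarrow> 'e set) \<Rightarrow> bool"
where
  "subbundle A D \<longleftrightarrow>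
     (\<forall>x. \<exists>U (k::nat) F. open U \<and> x \<in> U \<and>
        (\<forall>i<k. smooth_field_on A U (F i)) \<and>
        (\<forall>y\<in>U. inj_on (\<lambda>i. F i y) {..<k} \<and> independent ((\<lambda>i. F i y) ` {..<k}) \<and>
           span ((\<lambda>i. F i y) ` {..<k}) = D y))"

definition section_on ::
  "('m::topological_space, 'e::real_inner) atlas \<Rightarrow> ('m \<Rightarrow> 'e set) \<Rightarrow> 'm set \<Rightarrow> ('m \<Rightarrow> 'e) \<Rightarrow> bool"
where
  "section_on A D U X \<longleftrightarrow> smooth_field_on A U X \<and> (\<forall>x\<in>U. X x \<in> D x)"

text \<open>Alternating multilinear forms on a linear subspace \<open>S\<close>.\<close>

definition alt1 :: "'e::real_vector set \<Rightarrow> ('e \<Rightarrow> real) \<Rightarrow> bool"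
where
  "alt1 S \<theta> \<longleftrightarrow>
     (\<forall>u\<in>S. \<forall>v\<in>S. \<theta> (u + v) = \<theta> u + \<theta> v) \<and> (\<forall>r. \<forall>u\<in>S. \<theta> (r *\<^sub>R u) = r * \<theta> u)"

definition alt2 :: "'e::real_vector set \<Rightarrow> ('e \<Rightarrow> 'e \<Rightarrow> real) \<Rightarrow> bool"
where
  "alt2 S \<eta> \<longleftrightarrow>
     (\<forall>u\<in>S. alt1 S (\<lambda>v. \<eta> u v)) \<and> (\<forall>v\<in>S. alt1 S (\<lambda>u. \<eta> u v)) \<and> (\<forall>u\<in>S. \<eta> u u = 0)"

definition alt3 :: "'e::real_vector set \<Rightarrow> ('e \<Rightarrow> 'e \<Rightarrow> 'e \<Rightarrow> real) \<Rightarrow> bool"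
where
  "alt3 S \<phi> \<longleftrightarrow>
     (\<forall>u\<in>S. alt2 S (\<lambda>v w. \<phi> u v w)) \<and> (\<forall>v\<in>S. \<forall>w\<in>S. alt1 S (\<lambda>u. \<phi> u v w)) \<and>
     (\<forall>u\<in>S. \<forall>w\<in>S. \<phi> u u w = 0)"

text \<open>
  Smooth \<open>q\<close>-forms on a subbundle \<open>D\<close>, i.e. sections of the \<open>q\<close>-th exterior power of the dual of \<open>D\<close>.
  With \<open>D = TM\<close> these are the differential forms on the manifold, with \<open>D = V\<close> (the vertical bundle)
  the vertical forms. Only the values on vectors of \<open>D\<close> are relevant.
\<close>

abbreviation TM :: "'m \<Rightarrow> 'e set"
  where "TM \<equiv> \<lambda>_. UNIV"

definition form1 ::
  "('m::topological_space, 'e::real_inner) atlas \<Rightarrow> ('m \<Rightarrow> 'e set) \<Rightarrow> ('m \<Rightarrow> 'e \<Rightarrow> real) \<Rightarrow> bool"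
where
  "form1 A D \<alpha> \<longleftrightarrow>
     (\<forall>x. alt1 (D x) (\<alpha> x)) \<and>
     (\<forall>U X. open U \<and> section_on A D U X \<longrightarrow> smooth_fun_on A U (\<lambda>x. \<alpha> x (X x)))"

definition form3 ::
  "('m::topological_space, 'e::real_inner) atlas \<Rightarrow> ('m \<Rightarrow> 'e set)
    \<Rightarrow> ('m \<Rightarrow> 'e \<Rightarrow> 'e \<Rightarrow> 'e \<Rightarrow> real) \<Rightarrow> bool"
where
  "form3 A D \<Phi> \<longleftrightarrow>
     (\<forall>x. alt3 (D x) (\<Phi> x)) \<and>
     (\<forall>U X Y Z. open U \<and> section_on A D U X \<and> section_on A D U Y \<and> section_on A D U Z
        \<longrightarrow> smooth_fun_on A U (\<lambda>x. \<Phi> x (X x) (Y x) (Z x)))"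

text \<open>
  The de Rham differential, evaluated on vector fields by the invariant (Koszul) formula
  \[ d\alpha(X_0,\dots,X_q) = \sum_i (-1)^i X_i\,\alpha(\dots,\hat X_i,\dots)
     + \sum_{i<j} (-1)^{i+j} \alpha([X_i,X_j],\dots,\hat X_i,\dots,\hat X_j,\dots). \]
  On an involutive subbundle \<open>D\<close>, the same formula with sections of \<open>D\<close> gives the differential of
  forms on \<open>D\<close>; for the vertical bundle this is the vertical differential.
\<close>

definition ext_d1 ::
  "('m, 'e::real_inner) atlas \<Rightarrow> ('m \<Rightarrow> 'e \<Rightarrow> real) \<Rightarrow> ('m \<Rightarrow> 'e) \<Rightarrow> ('m \<Rightarrow> 'e) \<Rightarrow> 'm \<Rightarrow> real"
where
  "ext_d1 A \<alpha> X Y x =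
     dir_deriv A X (\<lambda>y. \<alpha> y (Y y)) x - dir_deriv A Y (\<lambda>y. \<alpha> y (X y)) x
     - \<alpha> x (lie_bracket A X Y x)"

definition ext_d3 ::
  "('m, 'e::real_inner) atlas \<Rightarrow> ('m \<Rightarrow> 'e \<Rightarrow> 'e \<Rightarrow> 'e \<Rightarrow> real)
    \<Rightarrow> ('m \<Rightarrow> 'e) \<Rightarrow> ('m \<Rightarrow> 'e) \<Rightarrow> ('m \<Rightarrow> 'e) \<Rightarrow> ('m \<Rightarrow> 'e) \<Rightarrow> 'm \<Rightarrow> real"
where
  "ext_d3 A \<Phi> W X Y Z x =
       dir_deriv A W (\<lambda>y. \<Phi> y (X y) (Y y) (Z y)) x
     - dir_deriv A X (\<lambda>y. \<Phi> y (W y) (Y y) (Z y)) x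
     + dir_deriv A Y (\<lambda>y. \<Phi> y (W y) (X y) (Z y)) x
     - dir_deriv A Z (\<lambda>y. \<Phi> y (W y) (X y) (Y y)) x
     - \<Phi> x (lie_bracket A W X x) (Y x) (Z x)
     + \<Phi> x (lie_bracket A W Y x) (X x) (Z x)
     - \<Phi> x (lie_bracket A W Z x) (X x) (Y x)
     - \<Phi> x (lie_bracket A X Y x) (W x) (Z x)
     + \<Phi> x (lie_bracket A X Z x) (W x) (Y x)
     - \<Phi> x (lie_bracket A Y Z x) (W x) (X x)"

definition closed3 ::
  "('m::topological_space, 'e::real_inner) atlas \<Rightarrow> ('m \<Rightarrow> 'e set)
    \<Rightarrow> ('m \<Rightarrow> 'e \<Rightarrow> 'e \<Rightarrow> 'e \<Rightarrow> real) \<Rightarrow> bool"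
where
  "closed3 A D \<Phi> \<longleftrightarrow>
     (\<forall>U W X Y Z. open U \<and> section_on A D U W \<and> section_on A D U X \<and>
        section_on A D U Y \<and> section_on A D U Z
        \<longrightarrow> (\<forall>x\<in>U. ext_d3 A \<Phi> W X Y Z x = 0))"

definition lie_deriv3 ::
  "('m, 'e::real_inner) atlas \<Rightarrow> ('m \<Rightarrow> 'e) \<Rightarrow> ('m \<Rightarrow> 'e \<Rightarrow> 'e \<Rightarrow> 'e \<Rightarrow> real)
    \<Rightarrow> ('m \<Rightarrow> 'e) \<Rightarrow> ('m \<Rightarrow> 'e) \<Rightarrow> ('m \<Rightarrow> 'e) \<Rightarrow> 'm \<Rightarrow> real"
where
  "lie_deriv3 A W \<Phi> X Y Z x =
       dir_deriv A W (\<lambda>y. \<Phi> y (X y) (Y y) (Z y)) x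
     - \<Phi> x (lie_bracket A W X x) (Y x) (Z x)
     - \<Phi> x (X x) (lie_bracket A W Y x) (Z x)
     - \<Phi> x (X x) (Y x) (lie_bracket A W Z x)"


section \<open>Fibrations and Ehresmann connections\<close>

definition vertical ::
  "('m, 'e::real_inner) atlas \<Rightarrow> ('b, 'f::real_inner) atlas \<Rightarrow> ('m \<Rightarrow> 'b) \<Rightarrow> 'm \<Rightarrow> 'e set"
  where "vertical A B p x = {v. tangent_map A B p x v = 0}"

definition ehresmann_connection ::
  "('m::topological_space, 'e::real_inner) atlas \<Rightarrow> ('b, 'f::real_inner) atlas \<Rightarrow> ('m \<Rightarrow> 'b)
    \<Rightarrow> ('m \<Rightarrow> 'e set) \<Rightarrow> bool"
where
  "ehresmann_connection A B p Hor \<longleftrightarrow>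
     subbundle A Hor \<and>
     (\<forall>x. vertical A B p x \<inter> Hor x = {0} \<and>
          {v + w | v w. v \<in> vertical A B p x \<and> w \<in> Hor x} = UNIV)"

text \<open>Completeness: every smooth curve in the base has a global horizontal lift through any given
  point over its initial point.\<close>

definition complete_connection ::
  "('m::topological_space, 'e::real_inner) atlas \<Rightarrow> ('b::topological_space, 'f::real_inner) atlas
    \<Rightarrow> ('m \<Rightarrow> 'b) \<Rightarrow> ('m \<Rightarrow> 'e set) \<Rightarrow> bool"
where
  "complete_connection A B p Hor \<longleftrightarrow>
     (\<forall>\<gamma> x. smooth_map real_line B \<gamma> \<and> \<gamma> 0 = p x \<longrightarrow>
        (\<exists>\<sigma>. smooth_map real_line A \<sigma> \<and> \<sigma> 0 = x \<and> p \<circ> \<sigma> = \<gamma> \<and>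
           (\<forall>t. tangent_map real_line A \<sigma> t 1 \<in> Hor (\<sigma> t))))"

definition fibration ::
  "('m::{t2_space, second_countable_topology}, 'e::real_inner) atlas
    \<Rightarrow> ('b::{t2_space, second_countable_topology}, 'f::real_inner) atlas \<Rightarrow> ('m \<Rightarrow> 'b) \<Rightarrow> bool"
where
  "fibration A B p \<longleftrightarrow>
     smooth_manifold A \<and> smooth_manifold B \<and> smooth_map A B p \<and>
     (\<forall>x. surj (tangent_map A B p x)) \<and>
     (\<exists>Hor. ehresmann_connection A B p Hor \<and> complete_connection A B p Hor)"

definition hor_lift ::
  "('m, 'e::real_inner) atlas \<Rightarrow> ('b, 'f::real_inner) atlas \<Rightarrow> ('m \<Rightarrow> 'b)
    \<Rightarrow> ('m \<Rightarrow> 'e set) \<Rightarrow> ('b \<Rightarrow> 'f) \<Rightarrow> 'm \<Rightarrow> 'e"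
  where "hor_lift A B p Hor u x = (THE w. w \<in> Hor x \<and> tangent_map A B p x w = u (p x))"

definition curvature ::
  "('m, 'e::real_inner) atlas \<Rightarrow> ('b, 'f::real_inner) atlas \<Rightarrow> ('m \<Rightarrow> 'b)
    \<Rightarrow> ('m \<Rightarrow> 'e set) \<Rightarrow> ('b \<Rightarrow> 'f) \<Rightarrow> ('b \<Rightarrow> 'f) \<Rightarrow> 'm \<Rightarrow> 'e"
where
  "curvature A B p Hor u v x =
     lie_bracket A (hor_lift A B p Hor u) (hor_lift A B p Hor v) x
     - hor_lift A B p Hor (lie_bracket B u v) x"


section \<open>2-plectic structures\<close>

text \<open>
  The exterior square of a subspace \<open>W\<close> of \<open>'e\<close>: a bivector \<open>X 0 \<and> Y 0 + ... + X (n - 1) \<and> Y (n - 1)\<close>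
  is encoded as the functional \<open>\<eta> \<mapsto> (\<Sum>i<n. \<eta> (X i) (Y i))\<close> on the space of alternating bilinear forms
  on \<open>'e\<close> (set to 0 on functions that are not alternating bilinear).
\<close>

definition wedge :: "'e::real_vector \<Rightarrow> 'e \<Rightarrow> ('e \<Rightarrow> 'e \<Rightarrow> real) \<Rightarrow> real"
  where "wedge X Y \<eta> = (if alt2 UNIV \<eta> then \<eta> X Y else 0)"

definition ext_square :: "'e::real_vector set \<Rightarrow> (('e \<Rightarrow> 'e \<Rightarrow> real) \<Rightarrow> real) set"
where
  "ext_square W =
     {\<lambda>\<eta>. (\<Sum>i<n. wedge (X i) (Y i) \<eta>) | (n::nat) X Y. \<forall>i<n. X i \<in> W \<and> Y i \<in> W}"

definition annihilator :: "'e::real_vector set \<Rightarrow> ('e \<Rightarrow> real) set"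
  where "annihilator W = {\<theta>. alt1 UNIV \<theta> \<and> (\<forall>v\<in>W. \<theta> v = 0)}"

definition annihilator2 :: "(('e::real_vector \<Rightarrow> 'e \<Rightarrow> real) \<Rightarrow> real) set \<Rightarrow> ('e \<Rightarrow> 'e \<Rightarrow> real) set"
  where "annihilator2 S = {\<eta>. alt2 UNIV \<eta> \<and> (\<forall>b\<in>S. b \<eta> = 0)}"

text \<open>The contractions \<open>i\<^sub>X \<phi>\<close> with a vector and \<open>i\<^sub>b \<phi>\<close> with a bivector; the latter satisfies
  \<open>contract2 (wedge X Y) \<phi> Z = \<phi> X Y Z\<close>.\<close>

definition contract1 :: "'e::real_vector \<Rightarrow> ('e \<Rightarrow> 'e \<Rightarrow> 'e \<Rightarrow> real) \<Rightarrow> 'e \<Rightarrow> 'e \<Rightarrow> real"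
  where "contract1 X \<phi> = (\<lambda>Y Z. \<phi> X Y Z)"

definition contract2 ::
  "(('e::real_vector \<Rightarrow> 'e \<Rightarrow> real) \<Rightarrow> real) \<Rightarrow> ('e \<Rightarrow> 'e \<Rightarrow> 'e \<Rightarrow> real) \<Rightarrow> 'e \<Rightarrow> real"
  where "contract2 b \<phi> = (\<lambda>Z. b (\<lambda>X Y. \<phi> X Y Z))"

definition fibres_2plectically ::
  "('m, 'e::real_inner) atlas \<Rightarrow> ('b, 'f::real_inner) atlas \<Rightarrow> ('m \<Rightarrow> 'b)
    \<Rightarrow> ('m \<Rightarrow> 'e \<Rightarrow> 'e \<Rightarrow> 'e \<Rightarrow> real) \<Rightarrow> bool"
where
  "fibres_2plectically A B p \<Phi> \<longleftrightarrow>
     (\<forall>x. let V = vertical A B p x in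
        {(X, contract1 X (\<Phi> x)) | X. X \<in> UNIV} \<inter> (V \<times> annihilator2 (ext_square V))
          = {(0, \<lambda>_ _. 0)} \<and>
        {(b, contract2 b (\<Phi> x)) | b. b \<in> ext_square UNIV} \<inter> (ext_square V \<times> annihilator V)
          = {(\<lambda>_. 0, \<lambda>_. 0)})"

definition vertical_component ::
  "('m, 'e::real_inner) atlas \<Rightarrow> ('b, 'f::real_inner) atlas \<Rightarrow> ('m \<Rightarrow> 'b)
    \<Rightarrow> ('m \<Rightarrow> 'e \<Rightarrow> 'e \<Rightarrow> 'e \<Rightarrow> real) \<Rightarrow> 'm \<Rightarrow> 'e \<Rightarrow> 'e \<Rightarrow> 'e \<Rightarrow> real"
where
  "vertical_component A B p \<Phi> x X Y Z =
     (if {X, Y, Z} \<subseteq> vertical A B p x then \<Phi> x X Y Z else 0)"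

definition fibration_2plectic_fibres ::
  "('m::{t2_space, second_countable_topology}, 'e::real_inner) atlas
    \<Rightarrow> ('b::{t2_space, second_countable_topology}, 'f::real_inner) atlas \<Rightarrow> ('m \<Rightarrow> 'b)
    \<Rightarrow> ('m \<Rightarrow> 'e \<Rightarrow> 'e \<Rightarrow> 'e \<Rightarrow> real) \<Rightarrow> bool"
where
  "fibration_2plectic_fibres A B p \<Phi>V \<longleftrightarrow>
     fibration A B p \<and>
     form3 A (vertical A B p) \<Phi>V \<and>
     closed3 A (vertical A B p) \<Phi>V \<and>
     (\<forall>x. \<forall>X\<in>vertical A B p x.
        (\<forall>Y\<in>vertical A B p x. \<forall>Z\<in>vertical A B p x. \<Phi>V x X Y Z = 0) \<longrightarrow> X = 0)"

definition connection_2plectic ::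
  "('m::topological_space, 'e::real_inner) atlas \<Rightarrow> ('b::topological_space, 'f::real_inner) atlas
    \<Rightarrow> ('m \<Rightarrow> 'b) \<Rightarrow> ('m \<Rightarrow> 'e \<Rightarrow> 'e \<Rightarrow> 'e \<Rightarrow> real) \<Rightarrow> ('m \<Rightarrow> 'e set) \<Rightarrow> bool"
where
  "connection_2plectic A B p \<Phi>V Hor \<longleftrightarrow>
     ehresmann_connection A B p Hor \<and>
     (\<forall>u. smooth_field_on B UNIV u \<longrightarrow>
        (\<forall>U X Y Z. open U \<and> section_on A (vertical A B p) U X \<and>
           section_on A (vertical A B p) U Y \<and> section_on A (vertical A B p) U Z
           \<longrightarrow> (\<forall>x\<in>U. lie_deriv3 A (hor_lift A B p Hor u) \<Phi>V X Y Z x = 0)))"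

text \<open>
  A 2-form on \<open>B\<close> with values in vertical 1-forms on \<open>M\<close> is a function \<open>\<omega>\<close> such that \<open>\<omega> x u v w\<close> is
  defined for \<open>u, v\<close> tangent to \<open>B\<close> at \<open>p x\<close> and \<open>w\<close> vertical at \<open>x\<close>.
\<close>

definition base_form2_vertical_form1 ::
  "('m::topological_space, 'e::real_inner) atlas \<Rightarrow> ('b::topological_space, 'f::real_inner) atlas
    \<Rightarrow> ('m \<Rightarrow> 'b) \<Rightarrow> ('m \<Rightarrow> 'f \<Rightarrow> 'f \<Rightarrow> 'e \<Rightarrow> real) \<Rightarrow> bool"
where
  "base_form2_vertical_form1 A B p \<omega> \<longleftrightarrow>
     (\<forall>x. (\<forall>w\<in>vertical A B p x. alt2 UNIV (\<lambda>u v. \<omega> x u v w)) \<and>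
          (\<forall>u v. alt1 (vertical A B p x) (\<omega> x u v))) \<and>
     (\<forall>N u v. open N \<and> smooth_field_on B N u \<and> smooth_field_on B N v
        \<longrightarrow> (\<forall>U Y. open U \<and> p ` U \<subseteq> N \<and> section_on A (vertical A B p) U Y
              \<longrightarrow> smooth_fun_on A U (\<lambda>x. \<omega> x (u (p x)) (v (p x)) (Y x))))"

definition hamiltonian_curvature ::
  "('m::topological_space, 'e::real_inner) atlas \<Rightarrow> ('b::topological_space, 'f::real_inner) atlas
    \<Rightarrow> ('m \<Rightarrow> 'b) \<Rightarrow> ('m \<Rightarrow> 'e \<Rightarrow> 'e \<Rightarrow> 'e \<Rightarrow> real) \<Rightarrow> ('m \<Rightarrow> 'e set) \<Rightarrow> bool"
where
  "hamiltonian_curvature A B p \<Phi>V Hor \<longleftrightarrow>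
     (\<exists>\<omega>. base_form2_vertical_form1 A B p \<omega> \<and>
        (\<forall>u v. smooth_field_on B UNIV u \<and> smooth_field_on B UNIV v
           \<longrightarrow> (\<forall>U Y Z. open U \<and> section_on A (vertical A B p) U Y \<and>
                  section_on A (vertical A B p) U Z
                 \<longrightarrow> (\<forall>x\<in>U. - contract1 (curvature A B p Hor u v x) (\<Phi>V x) (Y x) (Z x) =
                        ext_d1 A (\<lambda>y. \<omega> y (u (p y)) (v (p y))) Y Z x))))"

end

theory Submission
  imports Defs
begin

text \<open>
  Condition (i) says that \<open>X \<mapsto> i\<^sub>X \<Phi>\<close> is injective from \<open>\<V>\<close> to the 2-forms on \<open>\<V>\<close>, condition
  (ii) that \<open>b \<mapsto> i\<^sub>b \<Phi>\<close> is injective on the bivectors of \<open>\<V>\<close>. By the second, \<open>n(n-1)/2 \<le> n\<close> for the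
  fibre dimension \<open>n\<close>, so that \<open>n \<le> 3\<close>, and the first leaves only \<open>n = 0\<close> and \<open>n = 3\<close>. In the
  second case \<open>\<Phi>\<^sub>V\<close> is a volume form along the fibres, and Cramer's rule shows that the vectors \<open>w\<close>
  with \<open>\<Phi>(w, Y, Z) = 0\<close> for all vertical \<open>Y, Z\<close> form a smooth complement \<open>Hor\<close> of \<open>\<V>\<close>.

  For this connection the identity \<open>d\<Phi>(h(u), X, Y, Z) = 0\<close> with \<open>X, Y, Z\<close> vertical reduces to
  \<open>\<L>\<^bsub>h(u)\<^esub> \<Phi>\<^sub>V = 0\<close>, because brackets of vertical fields with vertical fields or horizontal lifts
  are vertical. Similarly \<open>d\<Phi>(h(u), h(v), Y, Z) = 0\<close> says that the curvature is hamiltonian, with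
  \<open>\<omega>(u, v) = - \<Phi>(h(u), h(v), \<cdot>)\<close>.
\<close>

section \<open>Smooth maps between normed spaces\<close>

text \<open>Up to sign, condition (ii) is the injectivity of the transpose of the map in condition
  (i). Together they make contraction with \<Phi> an isomorphism from the vertical vectors onto the
  vertical 2-forms. Hence every tangent vector has exactly one vertical part with the same
  contraction on vertical pairs, and the remainders form a complement. The dimension of a fibre is
  never computed. Nondegeneracy gives either no nonzero vertical vector or three of them on which
  \<Phi> does not vanish, and the bound 3 on independent sets makes such a triple a basis. Since
  nonvanishing is an open condition, the Cramer quotients are smooth nearby. The analytic difficulty
  is that a tangent vector is recorded in a chart chosen at its point, and this choice may jump.
  Vertical fields and lifts are therefore built inside a single chart, from the least-norm right
  inverse of the differential of \<open>p\<close>. That brackets of related fields are related is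
  also checked in charts, where it rests on the symmetry of second derivatives.\<close>

lemma differentiable_times_mono:
  "differentiable_times k S f \<Longrightarrow> T \<subseteq> S \<Longrightarrow> differentiable_times k T f"
  by (induction k arbitrary: f) (auto intro: continuous_on_subset)

lemma differentiable_times_cong:
  assumes "open S" "\<And>z. z \<in> S \<Longrightarrow> f z = g z" "differentiable_times k S f"
  shows "differentiable_times k S g"
  using assms(2,3)
proof (induction k arbitrary: f g)
  case 0
  then show ?case by (auto cong: continuous_on_cong)
next
  case (Suc k)
  have d: "frechet_derivative f (at z) = frechet_derivative g (at z)" if "z \<in> S" for z
    using Suc.prems assms(1) that by (intro frechet_derivative_transform_within_open[of _ _ S]) auto
  have "g differentiable at z" if "z \<in> S" for z
  proof -
    have "(f has_derivative frechet_derivative f (at z)) (at z)"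
      using Suc.prems(2) that by (simp add: frechet_derivative_works[symmetric])
    from has_derivative_transform_within_open[OF this assms(1) that, of g]
    show ?thesis using Suc.prems(1) by (auto simp: differentiable_def)
  qed
  moreover have "differentiable_times k S (\<lambda>z. frechet_derivative g (at z) v)" for v
  proof (rule Suc.IH)
    show "frechet_derivative f (at z) v = frechet_derivative g (at z) v" if "z \<in> S" for z
      using d[OF that] by simp
    show "differentiable_times k S (\<lambda>z. frechet_derivative f (at z) v)" using Suc.prems(2) by simp
  qed
  ultimately show ?case by simp
qed

text \<open>Derivatives are taken at points of the whole space and not within \<open>S\<close>, so
  they do not depend on the neighbourhood \<open>T\<close>. Its openness matters for continuity at
  order zero.\<close>

lemma differentiable_times_local:
  assumes "\<And>z. z \<in> S \<Longrightarrow> \<exists>T. open T \<and> z \<in> T \<and> differentiable_times k T f"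
  shows "differentiable_times k S f"
  using assms
proof (induction k arbitrary: f)
  case 0
  have "isCont f z" if "z \<in> S" for z
    using 0[OF that] by (auto simp: continuous_on_eq_continuous_at)
  then show ?case by (simp add: continuous_at_imp_continuous_on)
next
  case (Suc k)
  have "f differentiable at z" if "z \<in> S" for z using Suc.prems[OF that] by auto
  moreover have "differentiable_times k S (\<lambda>z. frechet_derivative f (at z) v)" for v
    by (rule Suc.IH) (use Suc.prems in \<open>auto dest!: Suc.prems\<close>)
  ultimately show ?case by simp
qed

lemma differentiable_times_lower:
  "differentiable_times (Suc k) S f \<Longrightarrow> differentiable_times k S f"
proof (induction k arbitrary: f)
  case 0
  then show ?case
    by (auto intro!: continuous_at_imp_continuous_on differentiable_imp_continuous_within)
next
  case (Suc k)
  then show ?case by (metis differentiable_times.simps(2))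
qed

lemma differentiable_times_const: "differentiable_times k S (\<lambda>z. c)"
  by (induction k arbitrary: c) auto

lemma differentiable_times_add:
  assumes "open S"
  shows "differentiable_times k S f \<Longrightarrow> differentiable_times k S g
    \<Longrightarrow> differentiable_times k S (\<lambda>z. f z + g z)"
proof (induction k arbitrary: f g)
  case 0
  then show ?case by (auto intro: continuous_intros)
next
  case (Suc k)
  have d: "((\<lambda>z. f z + g z) has_derivative
      (\<lambda>v. frechet_derivative f (at z) v + frechet_derivative g (at z) v)) (at z)" if "z \<in> S" for z
    using Suc.prems that by (auto intro!: has_derivative_add simp: frechet_derivative_works[symmetric])
  have "differentiable_times k S (\<lambda>z. frechet_derivative (\<lambda>z. f z + g z) (at z) v)" for v
    by (rule differentiable_times_cong[OF assms _ Suc.IH[of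
          "\<lambda>z. frechet_derivative f (at z) v" "\<lambda>z. frechet_derivative g (at z) v"]])
      (use Suc.prems frechet_derivative_at[OF d] in \<open>auto simp: fun_eq_iff\<close>)
  with d show ?case by (auto simp: differentiable_def)
qed

lemma differentiable_times_sum:
  assumes "open S" "\<And>i. i \<in> I \<Longrightarrow> differentiable_times k S (f i)"
  shows "differentiable_times k S (\<lambda>z. \<Sum>i\<in>I. f i z)"
  using assms(2)
proof (induction I rule: infinite_finite_induct)
  case (insert i I)
  then show ?case using differentiable_times_add[OF assms(1), of k "f i"] by simp
qed (simp_all add: differentiable_times_const)

text \<open>Both factors are arbitrary in the induction because the product rule yields
  \<open>B\<close> of \<open>f\<close> and a derivative of \<open>g\<close>, and conversely. The
  undifferentiated factor enters at the lower order \<open>k\<close>.\<close>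

lemma differentiable_times_bilinear:
  assumes "open S" "bounded_bilinear B"
  shows "differentiable_times k S f \<Longrightarrow> differentiable_times k S g
    \<Longrightarrow> differentiable_times k S (\<lambda>z. B (f z) (g z))"
proof (induction k arbitrary: f g)
  case 0
  then show ?case by (simp add: bounded_bilinear.continuous_on[OF assms(2)])
next
  case (Suc k)
  have d: "((\<lambda>z. B (f z) (g z)) has_derivative
      (\<lambda>v. B (f z) (frechet_derivative g (at z) v) + B (frechet_derivative f (at z) v) (g z))) (at z)"
    if "z \<in> S" for z
    by (rule bounded_bilinear.FDERIV[OF assms(2)])
      (use Suc.prems that in \<open>simp_all add: frechet_derivative_works[symmetric]\<close>)
  have "differentiable_times k S (\<lambda>z. frechet_derivative (\<lambda>z. B (f z) (g z)) (at z) v)" for v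
    by (rule differentiable_times_cong[OF assms(1) _ differentiable_times_add[OF assms(1)
        Suc.IH[of f "\<lambda>z. frechet_derivative g (at z) v"]
        Suc.IH[of "\<lambda>z. frechet_derivative f (at z) v" g]]])
      (use Suc.prems frechet_derivative_at[OF d] differentiable_times_lower[OF Suc.prems(1)]
        differentiable_times_lower[OF Suc.prems(2)] in \<open>auto simp: fun_eq_iff\<close>)
  with d show ?case by (auto simp: differentiable_def)
qed

lemma differentiable_times_linear:
  assumes "open S" "bounded_linear L" "differentiable_times k S f"
  shows "differentiable_times k S (\<lambda>z. L (f z))"
  using assms(3)
proof (induction k arbitrary: f)
  case 0
  then show ?case by (simp add: bounded_linear.continuous_on[OF assms(2)])
next
  case (Suc k)
  have d: "((\<lambda>z. L (f z)) has_derivative (\<lambda>v. L (frechet_derivative f (at z) v))) (at z)"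
    if "z \<in> S" for z
    by (rule bounded_linear.has_derivative[OF assms(2)])
      (use Suc.prems that in \<open>simp add: frechet_derivative_works[symmetric]\<close>)
  have "differentiable_times k S (\<lambda>z. frechet_derivative (\<lambda>z. L (f z)) (at z) v)" for v
    by (rule differentiable_times_cong[OF assms(1) _ Suc.IH[of "\<lambda>z. frechet_derivative f (at z) v"]])
      (use Suc.prems frechet_derivative_at[OF d] in \<open>auto simp: fun_eq_iff\<close>)
  with d show ?case by (auto simp: differentiable_def)
qed

text \<open>The derivative of 1/f is, up to sign, the product of 1/f, Df and 1/f, so the induction
  hypothesis on 1/f itself feeds the product rule.\<close>

lemma differentiable_times_inverse:
  fixes f :: "'e::real_normed_vector \<Rightarrow> real"
  assumes "open S" "\<And>z. z \<in> S \<Longrightarrow> f z \<noteq> 0" "differentiable_times k S f"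
  shows "differentiable_times k S (\<lambda>z. inverse (f z))"
  using assms(3)
proof (induction k)
  case 0
  then show ?case using assms(2) by (auto intro!: continuous_on_inverse)
next
  case (Suc k)
  have d: "((\<lambda>z. inverse (f z)) has_derivative
      (\<lambda>v. - (inverse (f z) * frechet_derivative f (at z) v * inverse (f z)))) (at z)"
    if "z \<in> S" for z
    using Suc.prems that assms(2)
    by (intro Deriv.has_derivative_inverse) (auto simp: frechet_derivative_works[symmetric])
  have i: "differentiable_times k S (\<lambda>z. inverse (f z))"
    using Suc differentiable_times_lower by blast
  have "differentiable_times k S (\<lambda>z. frechet_derivative (\<lambda>z. inverse (f z)) (at z) v)" for v
    by (rule differentiable_times_cong[OF assms(1) _ differentiable_times_linear[OF assms(1)
        bounded_linear_minus[OF bounded_linear_ident]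
        differentiable_times_bilinear[OF assms(1) bounded_bilinear_mult
        differentiable_times_bilinear[OF assms(1) bounded_bilinear_mult i] i], of "\<lambda>z. frechet_derivative f (at z) v"]])
      (use Suc.prems frechet_derivative_at[OF d] in \<open>auto simp: fun_eq_iff\<close>)
  with d show ?case by (auto simp: differentiable_def)
qed

section \<open>Orthonormal bases of the model space, and the chain rule\<close>

definition orthonormal_basis :: "'e::real_inner set \<Rightarrow> bool" where
  "orthonormal_basis E \<longleftrightarrow> finite E \<and> span E = UNIV \<and> (\<forall>a\<in>E. \<forall>b\<in>E. a \<bullet> b = (if a = b then 1 else 0))"

text \<open>Gram-Schmidt by induction on the spanning set: a vector in the span of the earlier ones
  leaves remainder 0 and adds nothing. The resulting basis may be empty, which covers dimension
  0.\<close>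

lemma ex_orthonormal_basis:
  assumes "finite (S::'e::real_inner set)" "span S = UNIV"
  shows "\<exists>E::'e set. orthonormal_basis E"
proof -
  have "\<exists>E. finite E \<and> span E = span S \<and> (\<forall>a\<in>E. \<forall>b\<in>E. a \<bullet> b = (if a = b then 1 else (0::real)))"
    using assms(1)
  proof induction
    case empty
    show ?case by (rule exI[of _ "{}"]) simp
  next
    case (insert x S)
    then obtain E where E: "finite E" "span E = span S"
      and o: "\<And>a b. a \<in> E \<Longrightarrow> b \<in> E \<Longrightarrow> a \<bullet> b = (if a = b then 1 else 0)" by blast
    define r where "r = (\<Sum>a\<in>E. (x \<bullet> a) *\<^sub>R a)"
    define q where "q = x - r"
    have qa: "q \<bullet> a = 0" if "a \<in> E" for a
    proof -
      have "r \<bullet> a = (\<Sum>b\<in>E. (x \<bullet> b) * (if b = a then 1 else 0))"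
        unfolding r_def inner_sum_left using that o by (intro sum.cong) auto
      also have "\<dots> = x \<bullet> a" using E(1) that by (simp add: mult_delta_right)
      finally show ?thesis by (simp add: q_def inner_diff_left)
    qed
    have rS: "r \<in> span E" unfolding r_def by (intro span_sum span_scale span_base)
    have sp: "span (insert x S) = span (insert q E)"
    proof -
      have "span (insert x S) = span (insert x E)" by (simp add: span_insert E(2))
      also have "\<dots> = span (insert q E)" unfolding q_def by (rule eq_span_insert_eq) (simp add: rS)
      finally show ?thesis .
    qed
    show ?case
    proof (cases "q = 0")
      case True
      then show ?thesis using E o sp by (intro exI[of _ E]) (auto simp: span_insert_0)
    next
      case False
      let ?q = "q /\<^sub>R norm q"
      have "span (insert ?q E) = span (insert q E)"
      proof
        show "span (insert ?q E) \<subseteq> span (insert q E)"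
          by (rule span_minimal) (auto intro: span_base span_scale)
        have "q = norm q *\<^sub>R ?q" using False by simp
        then have "q \<in> span (insert ?q E)" by (metis insertI1 span_base span_scale)
        then show "span (insert q E) \<subseteq> span (insert ?q E)"
          by (intro span_minimal) (auto intro: span_base)
      qed
      moreover have "?q \<bullet> ?q = 1" using False
        by (simp add: power2_norm_eq_inner[symmetric] power2_eq_square)
      moreover have "?q \<notin> E" using qa[of ?q] False calculation(2) by auto
      ultimately show ?thesis using E(1) o sp qa
        by (intro exI[of _ "insert ?q E"]) (auto simp: inner_commute)
    qed
  qed
  then show ?thesis using assms(2) by (simp add: orthonormal_basis_def)
qed

lemma orthonormal_basis_expand:
  assumes "orthonormal_basis E"
  shows "(\<Sum>b\<in>E. (x \<bullet> b) *\<^sub>R b) = x"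
proof -
  have E: "finite E" "span E = UNIV" "\<And>a b. a \<in> E \<Longrightarrow> b \<in> E \<Longrightarrow> a \<bullet> b = (if a = b then 1 else 0)"
    using assms by (auto simp: orthonormal_basis_def)
  define q where "q = x - (\<Sum>b\<in>E. (x \<bullet> b) *\<^sub>R b)"
  have "q \<bullet> a = 0" if "a \<in> E" for a
  proof -
    have "(\<Sum>b\<in>E. (x \<bullet> b) *\<^sub>R b) \<bullet> a = (\<Sum>b\<in>E. (x \<bullet> b) * (if b = a then 1 else 0))"
      unfolding inner_sum_left using that E(3) by (intro sum.cong) auto
    also have "\<dots> = x \<bullet> a" using E(1) that by (simp add: mult_delta_right)
    finally show ?thesis by (simp add: q_def inner_diff_left)
  qed
  then have "span E \<subseteq> {y. q \<bullet> y = 0}"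
    by (intro span_minimal) (auto simp: subspace_def inner_add_right)
  moreover have "q \<in> span E" by (simp add: E(2))
  ultimately have "q \<bullet> q = 0" by blast
  then show ?thesis by (simp add: q_def)
qed

lemma linear_orthonormal_basis:
  assumes "orthonormal_basis E" "linear L"
  shows "L x = (\<Sum>b\<in>E. (x \<bullet> b) *\<^sub>R L b)"
  by (metis (no_types, lifting) assms linear_scale linear_sum orthonormal_basis_expand sum.cong)

text \<open>The inner derivative supplies a direction that moves with \<open>z\<close>, whereas
  \<open>differentiable_times\<close> speaks of fixed directions. Expanding along \<open>E\<close>
  leaves finitely many products of a coefficient of Dg with a derivative of \<open>f\<close> in a
  fixed direction, composed with \<open>g\<close>. The induction hypothesis applies to the latter,
  so \<open>f\<close> varies in the induction and \<open>g\<close> stays fixed.\<close>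

lemma differentiable_times_compose:
  fixes g :: "'e::real_normed_vector \<Rightarrow> 'f::real_inner"
  assumes E: "orthonormal_basis (E::'f set)" and "open S" "open T" "g ` S \<subseteq> T"
  shows "differentiable_times k T f \<Longrightarrow> differentiable_times k S g
    \<Longrightarrow> differentiable_times k S (\<lambda>z. f (g z))"
proof (induction k arbitrary: f)
  case 0
  then show ?case using assms by (auto intro: continuous_on_compose2)
next
  case (Suc k)
  have df: "f differentiable at (g z)" if "z \<in> S" for z
    using Suc.prems that assms by auto
  have d: "((\<lambda>z. f (g z)) has_derivative
      (\<lambda>v. frechet_derivative f (at (g z)) (frechet_derivative g (at z) v))) (at z)"
    if "z \<in> S" for z
    using Suc.prems that df[OF that]
    by (intro has_derivative_compose[of g _ _ _ f]) (auto simp: frechet_derivative_works[symmetric])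
  have g: "differentiable_times k S g" using Suc.prems differentiable_times_lower by blast
  have "differentiable_times k S (\<lambda>z. frechet_derivative (\<lambda>z. f (g z)) (at z) v)" for v
  proof (rule differentiable_times_cong[OF assms(2)])
    show "differentiable_times k S
        (\<lambda>z. \<Sum>b\<in>E. (frechet_derivative g (at z) v \<bullet> b) *\<^sub>R frechet_derivative f (at (g z)) b)"
      using Suc.prems g
      by (intro differentiable_times_sum differentiable_times_bilinear[OF _ bounded_bilinear_scaleR]
          differentiable_times_linear[OF _ bounded_linear_inner_left] assms
          Suc.IH[of "\<lambda>y. frechet_derivative f (at y) b" for b]) auto
    show "(\<Sum>b\<in>E. (frechet_derivative g (at z) v \<bullet> b) *\<^sub>R frechet_derivative f (at (g z)) b)
        = frechet_derivative (\<lambda>z. f (g z)) (at z) v" if "z \<in> S" for z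
      unfolding frechet_derivative_at[OF d[OF that], symmetric]
      by (rule linear_orthonormal_basis[OF E linear_frechet_derivative[OF df[OF that]], symmetric])
  qed
  with d show ?case by (auto simp: differentiable_def)
qed

section \<open>Calculus of smooth maps\<close>

lemma smooth_on_mono: "smooth_on S f \<Longrightarrow> T \<subseteq> S \<Longrightarrow> smooth_on T f"
  by (auto simp: smooth_on_def intro: differentiable_times_mono)

lemma smooth_on_cong:
  "open S \<Longrightarrow> (\<And>z. z \<in> S \<Longrightarrow> f z = g z) \<Longrightarrow> smooth_on S f \<Longrightarrow> smooth_on S g"
  unfolding smooth_on_def using differentiable_times_cong by blast

lemma smooth_on_local:
  assumes "\<And>z. z \<in> S \<Longrightarrow> \<exists>T. open T \<and> z \<in> T \<and> smooth_on T f"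
  shows "smooth_on S f"
  unfolding smooth_on_def
proof (intro allI differentiable_times_local)
  show "\<exists>T. open T \<and> z \<in> T \<and> differentiable_times k T f" if "z \<in> S" for k z
    using assms[OF that] by (auto simp: smooth_on_def)
qed

lemma smooth_on_differentiable: "smooth_on S f \<Longrightarrow> z \<in> S \<Longrightarrow> f differentiable at z"
  unfolding smooth_on_def by (metis differentiable_times.simps(2))

lemma smooth_on_continuous: "smooth_on S f \<Longrightarrow> continuous_on S f"
  unfolding smooth_on_def by (metis differentiable_times.simps(1))

lemma smooth_on_derivative: "smooth_on S f \<Longrightarrow> smooth_on S (\<lambda>z. frechet_derivative f (at z) v)"
  unfolding smooth_on_def by (metis differentiable_times.simps(2))

lemma smooth_on_const: "smooth_on S (\<lambda>z. c)"
  by (simp add: smooth_on_def differentiable_times_const)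

lemma smooth_on_add: "open S \<Longrightarrow> smooth_on S f \<Longrightarrow> smooth_on S g \<Longrightarrow> smooth_on S (\<lambda>z. f z + g z)"
  by (simp add: smooth_on_def differentiable_times_add)

lemma smooth_on_sum:
  "open S \<Longrightarrow> (\<And>i. i \<in> I \<Longrightarrow> smooth_on S (f i)) \<Longrightarrow> smooth_on S (\<lambda>z. \<Sum>i\<in>I. f i z)"
  by (simp add: smooth_on_def differentiable_times_sum)

lemma smooth_on_bilinear:
  "open S \<Longrightarrow> bounded_bilinear B \<Longrightarrow> smooth_on S f \<Longrightarrow> smooth_on S g \<Longrightarrow> smooth_on S (\<lambda>z. B (f z) (g z))"
  by (simp add: smooth_on_def differentiable_times_bilinear)

lemma smooth_on_linear:
  "open S \<Longrightarrow> bounded_linear L \<Longrightarrow> smooth_on S f \<Longrightarrow> smooth_on S (\<lambda>z. L (f z))"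
  by (simp add: smooth_on_def differentiable_times_linear)

lemmas smooth_on_inner = smooth_on_bilinear[OF _ bounded_bilinear_inner]
lemmas smooth_on_scaleR = smooth_on_bilinear[OF _ bounded_bilinear_scaleR]
lemmas smooth_on_mult = smooth_on_bilinear[OF _ bounded_bilinear_mult]
lemmas smooth_on_minus = smooth_on_linear[OF _ bounded_linear_minus[OF bounded_linear_ident]]

lemma smooth_on_diff: "open S \<Longrightarrow> smooth_on S f \<Longrightarrow> smooth_on S g \<Longrightarrow> smooth_on S (\<lambda>z. f z - g z)"
  using smooth_on_add[of S f "\<lambda>z. - g z"] smooth_on_minus[of S g] by simp

lemma smooth_on_divide:
  fixes f g :: "'e::real_normed_vector \<Rightarrow> real"
  shows "open S \<Longrightarrow> smooth_on S f \<Longrightarrow> smooth_on S g \<Longrightarrow> (\<And>z. z \<in> S \<Longrightarrow> g z \<noteq> 0)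
    \<Longrightarrow> smooth_on S (\<lambda>z. f z / g z)"
  using smooth_on_mult[of S f "\<lambda>z. inverse (g z)"]
  by (simp add: smooth_on_def differentiable_times_inverse divide_inverse)

lemma smooth_on_compose:
  fixes g :: "'e::real_normed_vector \<Rightarrow> 'f::real_inner"
  assumes "orthonormal_basis (E::'f set)" "open S" "open T" "g ` S \<subseteq> T" "smooth_on T f" "smooth_on S g"
  shows "smooth_on S (\<lambda>z. f (g z))"
  using assms by (auto simp: smooth_on_def intro: differentiable_times_compose)

text \<open>The expansion from the chain rule, now with base point and direction both moving.
  Coordinates of a vector field change between charts in exactly this way.\<close>

lemma smooth_on_derivative_apply:
  fixes w :: "'e::real_normed_vector \<Rightarrow> 'f::real_inner"
  assumes "orthonormal_basis (E::'f set)" "open S" "open T" "g ` S \<subseteq> T" "smooth_on T f"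
    "smooth_on S g" "smooth_on S w"
  shows "smooth_on S (\<lambda>z. frechet_derivative f (at (g z)) (w z))"
proof -
  have "smooth_on S (\<lambda>z. \<Sum>b\<in>E. (w z \<bullet> b) *\<^sub>R frechet_derivative f (at (g z)) b)"
    using assms by (intro smooth_on_sum smooth_on_scaleR smooth_on_inner smooth_on_const
      smooth_on_compose[OF assms(1-4) smooth_on_derivative]) auto
  moreover have "(\<Sum>b\<in>E. (w z \<bullet> b) *\<^sub>R frechet_derivative f (at (g z)) b) =
      frechet_derivative f (at (g z)) (w z)" if "z \<in> S" for z
    using assms that by (subst linear_orthonormal_basis[OF assms(1) linear_frechet_derivative])
      (auto intro: smooth_on_differentiable)
  ultimately show ?thesis
    by (rule smooth_on_cong[OF assms(2), rotated,
        of "\<lambda>z. \<Sum>b\<in>E. (w z \<bullet> b) *\<^sub>R frechet_derivative f (at (g z)) b"])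
qed

section \<open>Symmetry of second derivatives\<close>

text \<open>Two mean value theorems: one in \<open>s\<close> for the difference of \<open>f\<close>
  across the \<open>Y\<close>-side, one in \<open>t\<close> for the derivative in direction
  \<open>X\<close>. The left-hand side is symmetric in \<open>X\<close> and \<open>Y\<close>, the
  right-hand side is a mixed derivative.\<close>

lemma second_difference_mean_value:
  fixes f :: "'e::real_normed_vector \<Rightarrow> real"
  assumes "open S" "smooth_on S f" "h > 0"
    and S: "\<And>s t. 0 \<le> s \<Longrightarrow> s \<le> h \<Longrightarrow> 0 \<le> t \<Longrightarrow> t \<le> h \<Longrightarrow> z + s *\<^sub>R X + t *\<^sub>R Y \<in> S"
  shows "\<exists>s t. 0 < s \<and> s < h \<and> 0 < t \<and> t < h \<and>
    f (z + h *\<^sub>R X + h *\<^sub>R Y) - f (z + h *\<^sub>R X) - f (z + h *\<^sub>R Y) + f z =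
    h * h * frechet_derivative (\<lambda>y. frechet_derivative f (at y) X) (at (z + s *\<^sub>R X + t *\<^sub>R Y)) Y"
proof -
  let ?D = "\<lambda>y. frechet_derivative f (at y)"
  have D: "((\<lambda>s. f (z + s *\<^sub>R X + t *\<^sub>R Y)) has_real_derivative ?D (z + s *\<^sub>R X + t *\<^sub>R Y) X) (at s)"
    if "0 \<le> s" "s \<le> h" "0 \<le> t" "t \<le> h" for s t
  proof -
    have d: "(f has_derivative ?D (z + s *\<^sub>R X + t *\<^sub>R Y)) (at (z + s *\<^sub>R X + t *\<^sub>R Y))"
      using smooth_on_differentiable[OF assms(2) S[OF that]] frechet_derivative_works by blast
    have "((\<lambda>s. f (z + s *\<^sub>R X + t *\<^sub>R Y)) has_derivative (\<lambda>r. ?D (z + s *\<^sub>R X + t *\<^sub>R Y) (r *\<^sub>R X))) (at s)"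
      by (rule has_derivative_compose[where g=f and f="\<lambda>s. z + s *\<^sub>R X + t *\<^sub>R Y", OF _ d])
          (auto intro!: derivative_eq_intros)
    then show ?thesis
      using linear_scale[OF has_derivative_linear[OF d]]
      by (simp add: has_field_derivative_def mult.commute[of _ "_ X"] fun_eq_iff)
  qed
  \<comment> \<open>The term \<open>0 *\<^sub>R Y\<close> is kept so that both summands are
    instances of \<open>D\<close>, at \<open>t = h\<close> and \<open>t = 0\<close>.\<close>
  define g where "g = (\<lambda>s. f (z + s *\<^sub>R X + h *\<^sub>R Y) - f (z + s *\<^sub>R X + 0 *\<^sub>R Y))"
  have "\<exists>s>0. s < h \<and> g h - g 0 = (h - 0) * (?D (z + s *\<^sub>R X + h *\<^sub>R Y) X - ?D (z + s *\<^sub>R X + 0 *\<^sub>R Y) X)"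
    unfolding g_def using assms(3)
    by (intro MVT2 DERIV_diff D) auto
  then obtain s where s: "0 < s" "s < h"
    and g: "g h - g 0 = h * (?D (z + s *\<^sub>R X + h *\<^sub>R Y) X - ?D (z + s *\<^sub>R X + 0 *\<^sub>R Y) X)" by auto
  let ?E = "\<lambda>y. frechet_derivative (\<lambda>y. ?D y X) (at y)"
  have "((\<lambda>t. ?D (z + s *\<^sub>R X + t *\<^sub>R Y) X) has_real_derivative ?E (z + s *\<^sub>R X + t *\<^sub>R Y) Y) (at t)"
    if "0 \<le> t" "t \<le> h" for t
  proof -
    have d: "((\<lambda>y. ?D y X) has_derivative ?E (z + s *\<^sub>R X + t *\<^sub>R Y)) (at (z + s *\<^sub>R X + t *\<^sub>R Y))"
      using smooth_on_differentiable[OF smooth_on_derivative[OF assms(2)] S[OF _ _ that]]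
        frechet_derivative_works s by force
    have "((\<lambda>t. ?D (z + s *\<^sub>R X + t *\<^sub>R Y) X) has_derivative (\<lambda>r. ?E (z + s *\<^sub>R X + t *\<^sub>R Y) (r *\<^sub>R Y))) (at t)"
      by (rule has_derivative_compose[where g="\<lambda>y. ?D y X" and f="\<lambda>t. z + s *\<^sub>R X + t *\<^sub>R Y", OF _ d]) (auto intro!: derivative_eq_intros)
    then show ?thesis
      using linear_scale[OF has_derivative_linear[OF d]]
      by (simp add: has_field_derivative_def mult.commute[of _ "_ Y"] fun_eq_iff)
  qed
  then have "\<exists>t>0. t < h \<and> ?D (z + s *\<^sub>R X + h *\<^sub>R Y) X - ?D (z + s *\<^sub>R X + 0 *\<^sub>R Y) X
      = (h - 0) * ?E (z + s *\<^sub>R X + t *\<^sub>R Y) Y"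
    using assms(3) by (intro MVT2) auto
  then obtain t where t: "0 < t" "t < h"
    "?D (z + s *\<^sub>R X + h *\<^sub>R Y) X - ?D (z + s *\<^sub>R X + 0 *\<^sub>R Y) X = h * ?E (z + s *\<^sub>R X + t *\<^sub>R Y) Y"
    by auto
  show ?thesis
    using s t g unfolding g_def by (intro exI[of _ s] exI[of _ t]) (auto simp: algebra_simps)
qed

text \<open>Exchanging \<open>X\<close> and \<open>Y\<close> does not change the second difference,
  so the two mixed derivatives take a common value at points close to \<open>z\<close>. By
  continuity they cannot differ at \<open>z\<close>.\<close>

lemma second_derivative_symmetric_real:
  fixes f :: "'e::real_normed_vector \<Rightarrow> real"
  assumes "open S" "smooth_on S f" "z \<in> S"
  shows "frechet_derivative (\<lambda>y. frechet_derivative f (at y) X) (at z) Y =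
    frechet_derivative (\<lambda>y. frechet_derivative f (at y) Y) (at z) X"
proof (rule ccontr)
  define a where "a = (\<lambda>X Y y. frechet_derivative (\<lambda>y. frechet_derivative f (at y) X) (at y) Y)"
  assume "\<not> ?thesis"
  then have e: "dist (a X Y z) (a Y X z) / 2 > 0" (is "?e > 0") by (simp add: a_def)
  have "isCont (a U V) z" for U V
    using smooth_on_continuous[OF smooth_on_derivative[OF smooth_on_derivative[OF assms(2)]]] assms(1,3)
    by (auto simp: a_def continuous_on_eq_continuous_at)
  then have c: "\<forall>\<^sub>F y in nhds z. dist (a U V y) (a U V z) < ?e" for U V
    using e tendstoD unfolding isCont_def tendsto_at_iff_tendsto_nhds by blast
  have "\<forall>\<^sub>F y in nhds z. dist (a X Y y) (a X Y z) < ?e \<and> dist (a Y X y) (a Y X z) < ?e \<and> y \<in> S"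
    using c[of X Y] c[of Y X] eventually_nhds_in_open[OF assms(1,3)] by eventually_elim auto
  then obtain d where d: "d > 0" and
    b: "\<And>y. dist y z < d \<Longrightarrow> dist (a X Y y) (a X Y z) < ?e \<and> dist (a Y X y) (a Y X z) < ?e \<and> y \<in> S"
    unfolding eventually_nhds_metric by blast
  \<comment> \<open>This step keeps the whole parallelogram in the ball of radius \<open>d\<close>;
    the summand 1 keeps the denominator positive when \<open>X\<close> and \<open>Y\<close> are both
    0.\<close>
  define h where "h = d / (2 * (norm X + norm Y + 1))"
  have N: "norm X + norm Y + 1 > 0" by (simp add: add_nonneg_pos)
  then have h: "h > 0" using d by (simp add: h_def)
  have B: "dist (z + s *\<^sub>R X + t *\<^sub>R Y) z < d" if "0 \<le> s" "s \<le> h" "0 \<le> t" "t \<le> h" for s t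
  proof -
    have "dist (z + s *\<^sub>R X + t *\<^sub>R Y) z = norm (s *\<^sub>R X + t *\<^sub>R Y)"
      by (simp add: dist_norm)
    also have "\<dots> \<le> norm (s *\<^sub>R X) + norm (t *\<^sub>R Y)" by (rule norm_triangle_ineq)
    also have "\<dots> \<le> h * norm X + h * norm Y"
      using that by (intro add_mono) (auto intro!: mult_right_mono)
    also have "\<dots> < h * (2 * (norm X + norm Y + 1))"
      using h norm_ge_zero[of X] norm_ge_zero[of Y]
        by (simp add: algebra_simps add_pos_nonneg add_nonneg_pos)
    also have "\<dots> = d" using N by (simp add: h_def)
    finally show ?thesis .
  qed
  have B': "z + s *\<^sub>R Y + t *\<^sub>R X \<in> S" if "0 \<le> s" "s \<le> h" "0 \<le> t" "t \<le> h" for s t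
  proof -
    have "z + s *\<^sub>R Y + t *\<^sub>R X = z + t *\<^sub>R X + s *\<^sub>R Y" by simp
    then show ?thesis using b[OF B] that by metis
  qed
  have "\<exists>s t. 0 < s \<and> s < h \<and> 0 < t \<and> t < h \<and>
    f (z + h *\<^sub>R X + h *\<^sub>R Y) - f (z + h *\<^sub>R X) - f (z + h *\<^sub>R Y) + f z =
    h * h * a X Y (z + s *\<^sub>R X + t *\<^sub>R Y)" unfolding a_def
    by (rule second_difference_mean_value[OF assms(1,2) h]) (use B b in auto)
  then obtain s t where 1: "0 < s" "s < h" "0 < t" "t < h"
    "f (z + h *\<^sub>R X + h *\<^sub>R Y) - f (z + h *\<^sub>R X) - f (z + h *\<^sub>R Y) + f z =
        h * h * a X Y (z + s *\<^sub>R X + t *\<^sub>R Y)"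
    by blast
  have "\<exists>s t. 0 < s \<and> s < h \<and> 0 < t \<and> t < h \<and>
    f (z + h *\<^sub>R Y + h *\<^sub>R X) - f (z + h *\<^sub>R Y) - f (z + h *\<^sub>R X) + f z =
    h * h * a Y X (z + s *\<^sub>R Y + t *\<^sub>R X)" unfolding a_def
    by (rule second_difference_mean_value[OF assms(1,2) h]) (use B' in auto)
  then obtain s' t' where 2: "0 < s'" "s' < h" "0 < t'" "t' < h"
    "f (z + h *\<^sub>R Y + h *\<^sub>R X) - f (z + h *\<^sub>R Y) - f (z + h *\<^sub>R X) + f z =
        h * h * a Y X (z + s' *\<^sub>R Y + t' *\<^sub>R X)"
    by blast
  have e: "z + s *\<^sub>R Y + t *\<^sub>R X = z + t *\<^sub>R X + s *\<^sub>R Y" for s t by simp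
  have "h * h * a X Y (z + s *\<^sub>R X + t *\<^sub>R Y) = h * h * a Y X (z + t' *\<^sub>R X + s' *\<^sub>R Y)"
    using 1(5) 2(5) unfolding e by linarith
  then have "a X Y (z + s *\<^sub>R X + t *\<^sub>R Y) = a Y X (z + t' *\<^sub>R X + s' *\<^sub>R Y)" using h by simp
  moreover have "dist (a X Y (z + s *\<^sub>R X + t *\<^sub>R Y)) (a X Y z) < ?e" using b[OF B] 1 by auto
  moreover have "dist (a Y X (z + t' *\<^sub>R X + s' *\<^sub>R Y)) (a Y X z) < ?e" using b[OF B] 2 by auto
  \<comment> \<open>Both values at \<open>z\<close> lie within half their distance of one common
    number.\<close>
  ultimately show False
    using dist_triangle_half_r by (metis order.irrefl)
qed

lemma second_derivative_symmetric:
  fixes f :: "'e::real_normed_vector \<Rightarrow> 'f::real_inner"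
  assumes "open S" "smooth_on S f" "z \<in> S"
  shows "frechet_derivative (\<lambda>y. frechet_derivative f (at y) X) (at z) Y =
    frechet_derivative (\<lambda>y. frechet_derivative f (at y) Y) (at z) X"
proof -
  have i: "frechet_derivative g (at y) v \<bullet> b = frechet_derivative (\<lambda>y. g y \<bullet> b) (at y) v"
    if "g differentiable at y" for g :: "'e \<Rightarrow> 'f" and y v b
  proof -
    have "((\<lambda>y. g y \<bullet> b) has_derivative (\<lambda>v. frechet_derivative g (at y) v \<bullet> b)) (at y)"
      using that by (intro has_derivative_inner_left) (simp add: frechet_derivative_works[symmetric])
    from frechet_derivative_at[OF this] show ?thesis by (simp add: fun_eq_iff)
  qed
  have ii: "frechet_derivative (\<lambda>y. frechet_derivative f (at y) X) (at z) Y \<bullet> b =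
      frechet_derivative (\<lambda>y. frechet_derivative (\<lambda>y. f y \<bullet> b) (at y) X) (at z) Y" for X Y b
  proof -
    have "frechet_derivative (\<lambda>y. frechet_derivative f (at y) X \<bullet> b) (at z) =
      frechet_derivative (\<lambda>y. frechet_derivative (\<lambda>y. f y \<bullet> b) (at y) X) (at z)"
      using assms
      by (intro frechet_derivative_transform_within_open[of _ _ S])
       (auto intro!: i smooth_on_differentiable[of S] smooth_on_inner[of S] smooth_on_derivative smooth_on_const)
    then show ?thesis
      using i[OF smooth_on_differentiable[OF smooth_on_derivative[OF assms(2)] assms(3)]] by simp
  qed
  have "smooth_on S (\<lambda>y. f y \<bullet> b)" for b using assms by (intro smooth_on_inner smooth_on_const)
  then have "frechet_derivative (\<lambda>y. frechet_derivative f (at y) X) (at z) Y \<bullet> b =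
    frechet_derivative (\<lambda>y. frechet_derivative f (at y) Y) (at z) X \<bullet> b" for b
    unfolding ii using second_derivative_symmetric_real assms by blast
  then show ?thesis using vector_eq_rdot by blast
qed

section \<open>Smooth right inverses\<close>

text \<open>The system has the Gram matrix of \<open>g\<close>, invertible at each point by
  independence. Solving it by induction on \<open>J\<close> uses only sums, products and one
  division per step, which makes the smoothness of the coefficients evident.\<close>

lemma smooth_solution_in_span:
  fixes g :: "'i \<Rightarrow> 'e::real_normed_vector \<Rightarrow> 'f::real_inner"
  assumes "open S" "finite J"
  shows "(\<And>j. j \<in> J \<Longrightarrow> smooth_on S (g j)) \<Longrightarrow>
    (\<And>z a. z \<in> S \<Longrightarrow> (\<Sum>j\<in>J. a j *\<^sub>R g j z) = 0 \<Longrightarrow> \<forall>j\<in>J. a j = 0) \<Longrightarrow>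
    (\<And>j. j \<in> J \<Longrightarrow> smooth_on S (u j)) \<Longrightarrow>
    \<exists>a. (\<forall>j\<in>J. smooth_on S (a j)) \<and> (\<forall>z\<in>S. \<forall>i\<in>J. g i z \<bullet> (\<Sum>j\<in>J. a j z *\<^sub>R g j z) = u i z)"
  using assms(2)
proof (induction J arbitrary: u)
  case empty
  show ?case by simp
next
  case (insert k J)
  have ind: "\<forall>j\<in>J. a j = 0" if "z \<in> S" "(\<Sum>j\<in>J. a j *\<^sub>R g j z) = 0" for z a
  proof -
    have "(\<Sum>j\<in>insert k J. (if j = k then 0 else a j) *\<^sub>R g j z) = (\<Sum>j\<in>J. a j *\<^sub>R g j z)"
      using insert.hyps by (auto intro!: sum.cong)
    then have "\<forall>j\<in>insert k J. (if j = k then 0 else a j) = 0"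
      by (intro insert.prems(2)[OF that(1)]) (simp add: that)
    then show ?thesis using insert.hyps(2) by (metis insertCI)
  qed
  have sg: "\<And>j. j \<in> J \<Longrightarrow> smooth_on S (g j)" "smooth_on S (g k)" and su: "smooth_on S (u k)"
    and suJ: "\<And>j. j \<in> J \<Longrightarrow> smooth_on S (u j)" using insert.prems by auto
  have IH: "\<exists>a. (\<forall>j\<in>J. smooth_on S (a j)) \<and>
      (\<forall>z\<in>S. \<forall>i\<in>J. g i z \<bullet> (\<Sum>j\<in>J. a j z *\<^sub>R g j z) = y i z)"
    if "\<And>j. j \<in> J \<Longrightarrow> smooth_on S (y j)" for y
  proof (rule insert.IH)
    show "smooth_on S (g j)" if "j \<in> J" for j by (rule sg(1)[OF that])
    show "\<forall>j\<in>J. a j = 0" if "z \<in> S" "(\<Sum>j\<in>J. a j *\<^sub>R g j z) = 0" for z a by (rule ind[OF that])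
    show "smooth_on S (y j)" if "j \<in> J" for j by (rule \<open>\<And>j. j \<in> J \<Longrightarrow> smooth_on S (y j)\<close>[OF that])
  qed
  obtain a where a: "\<And>j. j \<in> J \<Longrightarrow> smooth_on S (a j)"
    and a': "\<And>z i. z \<in> S \<Longrightarrow> i \<in> J \<Longrightarrow> g i z \<bullet> (\<Sum>j\<in>J. a j z *\<^sub>R g j z) = u i z"
    using IH[of u] suJ by blast
  \<comment> \<open>With this right-hand side, the combination with coefficients \<open>r\<close> is
    the projection of \<open>g k\<close> onto the span of the others.\<close>
  have "\<exists>r. (\<forall>j\<in>J. smooth_on S (r j)) \<and> (\<forall>z\<in>S. \<forall>i\<in>J. g i z \<bullet> (\<Sum>j\<in>J. r j z *\<^sub>R g j z) = g i z \<bullet> g k z)"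
    by (rule IH) (rule smooth_on_inner[OF assms(1) sg])
  then obtain r where r: "\<And>j. j \<in> J \<Longrightarrow> smooth_on S (r j)"
    and r': "\<And>z i. z \<in> S \<Longrightarrow> i \<in> J \<Longrightarrow> g i z \<bullet> (\<Sum>j\<in>J. r j z *\<^sub>R g j z) = g i z \<bullet> g k z"
    by blast
  define w where "w = (\<lambda>z. \<Sum>j\<in>J. a j z *\<^sub>R g j z)"
  define q where "q = (\<lambda>z. g k z - (\<Sum>j\<in>J. r j z *\<^sub>R g j z))"
  \<comment> \<open>Adding a multiple of \<open>q\<close> leaves the equations for \<open>J\<close>
    intact. Since the inner products of \<open>q\<close> with \<open>g k\<close> and with itself
    agree, this quotient is what the equation for \<open>k\<close> requires.\<close>
  define t where "t = (\<lambda>z. (u k z - g k z \<bullet> w z) / (q z \<bullet> q z))"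
  define b where "b = (\<lambda>j. if j = k then t else (\<lambda>z. a j z - t z * r j z))"
  \<comment> \<open>a Gram-Schmidt step: \<open>q\<close> is the part of \<open>g k\<close> orthogonal to the other \<open>g j\<close>\<close>
  have q0: "q z \<noteq> 0" if "z \<in> S" for z
  proof
    assume "q z = 0"
    have "(\<Sum>j\<in>insert k J. (if j = k then 1 else - r j z) *\<^sub>R g j z) =
        g k z + (\<Sum>j\<in>J. (if j = k then 1 else - r j z) *\<^sub>R g j z)"
      using insert.hyps by simp
    also have "(\<Sum>j\<in>J. (if j = k then 1 else - r j z) *\<^sub>R g j z) = (\<Sum>j\<in>J. - (r j z *\<^sub>R g j z))"
      using insert.hyps(2) by (intro sum.cong) auto
    also have "g k z + \<dots> = q z" by (simp add: q_def sum_negf)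
    finally have "\<forall>j\<in>insert k J. (if j = k then 1 else - r j z) = 0"
      using \<open>q z = 0\<close> by (intro insert.prems(2)[OF that]) simp
    then show False by auto
  qed
  have gq: "g i z \<bullet> q z = 0" if "z \<in> S" "i \<in> J" for z i
    using r'[OF that] by (simp add: q_def inner_diff_right)
  have kq: "g k z \<bullet> q z = q z \<bullet> q z" if "z \<in> S" for z
  proof -
    have "(\<Sum>j\<in>J. r j z *\<^sub>R g j z) \<bullet> q z = 0"
      unfolding inner_sum_left using gq[OF that] by (intro sum.neutral) auto
    then show ?thesis by (simp add: q_def inner_diff_left)
  qed
  have sw: "smooth_on S w" and sq: "smooth_on S q"
    unfolding w_def q_def using assms(1) a r sg
    by (auto intro!: smooth_on_diff smooth_on_sum smooth_on_scaleR)
  have st: "smooth_on S t"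
    unfolding t_def using assms(1) sw sq su sg(2) q0
    by (intro smooth_on_divide smooth_on_diff smooth_on_inner) auto
  have sb: "smooth_on S (b j)" if "j \<in> insert k J" for j
    unfolding b_def using that st a r assms(1)
    by (auto intro!: smooth_on_diff smooth_on_mult)
  have sumb: "(\<Sum>j\<in>insert k J. b j z *\<^sub>R g j z) = w z + t z *\<^sub>R q z" for z
  proof -
    have "(\<Sum>j\<in>insert k J. b j z *\<^sub>R g j z) = t z *\<^sub>R g k z + (\<Sum>j\<in>J. b j z *\<^sub>R g j z)"
      using insert.hyps by (simp add: b_def)
    also have "(\<Sum>j\<in>J. b j z *\<^sub>R g j z) = (\<Sum>j\<in>J. a j z *\<^sub>R g j z - t z *\<^sub>R (r j z *\<^sub>R g j z))"
      using insert.hyps(2) by (intro sum.cong) (auto simp: b_def algebra_simps)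
    also have "t z *\<^sub>R g k z + \<dots> = w z + t z *\<^sub>R q z"
      by (simp add: w_def q_def sum_subtractf scaleR_sum_right scaleR_diff_right)
    finally show ?thesis .
  qed
  have "g i z \<bullet> (w z + t z *\<^sub>R q z) = u i z" if z: "z \<in> S" and "i \<in> insert k J" for z i
  proof (cases "i = k")
    case True
    have "t z * (q z \<bullet> q z) = u k z - g k z \<bullet> w z" using q0[OF z] by (simp add: t_def)
    then show ?thesis using True kq[OF z] by (simp add: inner_add_right)
  next
    case False
    then have "i \<in> J" using that by simp
    then show ?thesis using a'[OF z] gq[OF z] by (simp add: inner_add_right w_def)
  qed
  then show ?case unfolding sumb[symmetric] using sb by (intro exI[of _ b]) auto
qed

text \<open>Of all solutions, \<open>w\<close> is the one orthogonal to the kernel of the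
  derivative, that is, the one of least norm. It depends smoothly on \<open>z\<close> and vanishes
  where \<open>u\<close> does; the latter lets a vertical vector keep its value when a field through
  it is corrected by \<open>w\<close>.\<close>

lemma smooth_right_inverse:
  fixes P :: "'e::real_inner \<Rightarrow> 'f::real_inner"
  assumes E: "orthonormal_basis (E::'e set)" and F: "orthonormal_basis (F::'f set)"
    and "open S" "smooth_on S P" "\<And>z. z \<in> S \<Longrightarrow> surj (frechet_derivative P (at z))" "smooth_on S u"
  shows "\<exists>w. smooth_on S w \<and>
    (\<forall>z\<in>S. frechet_derivative P (at z) (w z) = u z \<and> (u z = 0 \<longrightarrow> w z = 0))"
proof -
  let ?D = "\<lambda>z. frechet_derivative P (at z)"
  \<comment> \<open>\<open>g j\<close> is the gradient of the component of \<open>P\<close> along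
    \<open>j\<close>, the adjoint of the derivative applied to \<open>j\<close>. These gradients
    span the orthogonal complement of the kernel.\<close>
  define g where "g = (\<lambda>j z. \<Sum>b\<in>E. (?D z b \<bullet> j) *\<^sub>R b)"
  have lin: "linear (?D z)" if "z \<in> S" for z
    using that assms(4) by (intro linear_frechet_derivative) (auto intro: smooth_on_differentiable)
  have g: "g j z \<bullet> v = ?D z v \<bullet> j" if "z \<in> S" for j z v
  proof -
    have "g j z \<bullet> v = (\<Sum>b\<in>E. (v \<bullet> b) *\<^sub>R ?D z b) \<bullet> j"
      by (simp add: g_def inner_sum_left mult.commute inner_commute[of v])
    also have "\<dots> = ?D z v \<bullet> j"
      by (simp only: linear_orthonormal_basis[OF E lin[OF that], of v])
    finally show ?thesis .
  qed
  have F': "finite F" "\<And>a b. a \<in> F \<Longrightarrow> b \<in> F \<Longrightarrow> a \<bullet> b = (if a = b then 1 else 0)"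
    using F by (auto simp: orthonormal_basis_def)
  have "\<exists>a. (\<forall>j\<in>F. smooth_on S (a j)) \<and>
      (\<forall>z\<in>S. \<forall>i\<in>F. g i z \<bullet> (\<Sum>j\<in>F. a j z *\<^sub>R g j z) = u z \<bullet> i)"
  proof (rule smooth_solution_in_span[where u = "\<lambda>j z. u z \<bullet> j"])
    show "smooth_on S (g j)" for j
      unfolding g_def using assms
      by (intro smooth_on_sum smooth_on_scaleR smooth_on_inner smooth_on_derivative smooth_on_const)
    show "smooth_on S (\<lambda>z. u z \<bullet> j)" for j using assms by (intro smooth_on_inner smooth_on_const)
    show "\<forall>j\<in>F. a j = 0" if "z \<in> S" "(\<Sum>j\<in>F. a j *\<^sub>R g j z) = 0" for z a
    proof -
      let ?y = "\<Sum>j\<in>F. a j *\<^sub>R j"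
      have y: "?D z v \<bullet> ?y = (\<Sum>j\<in>F. a j *\<^sub>R g j z) \<bullet> v" for v
        using g[OF that(1)] by (simp add: inner_sum_left inner_sum_right)
      have "surj (?D z)" by (rule assms(5)[OF that(1)])
      \<comment> \<open>By surjectivity the vector \<open>?y\<close> is itself a value of the
        derivative, so the assumed relation forces its square norm to be 0.\<close>
      then obtain v where "?D z v = ?y" by (metis surjD)
      then have "?y \<bullet> ?y = 0" using y[of v] that(2) by simp
      then have y0: "?y = 0" by simp
      have "a i = 0" if "i \<in> F" for i
      proof -
        have "?y \<bullet> i = (\<Sum>j\<in>F. a j * (if j = i then 1 else 0))"
          unfolding inner_sum_left using that F'(2) by (intro sum.cong) auto
        also have "\<dots> = a i" using F'(1) that by (simp add: mult_delta_right)
        finally show ?thesis using y0 by simp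
      qed
      then show ?thesis by blast
    qed
  qed (use assms F' in auto)
  then obtain a where a: "\<And>j. j \<in> F \<Longrightarrow> smooth_on S (a j)"
    and a': "\<And>z i. z \<in> S \<Longrightarrow> i \<in> F \<Longrightarrow> g i z \<bullet> (\<Sum>j\<in>F. a j z *\<^sub>R g j z) = u z \<bullet> i"
    by blast
  define w where "w = (\<lambda>z. \<Sum>j\<in>F. a j z *\<^sub>R g j z)"
  have sw: "smooth_on S w" unfolding w_def g_def using assms a
    by (intro smooth_on_sum smooth_on_scaleR smooth_on_inner smooth_on_derivative smooth_on_const) auto
  have gw: "g i z \<bullet> w z = u z \<bullet> i" if "z \<in> S" "i \<in> F" for z i
    using a'[OF that] by (simp add: w_def)
  have "?D z (w z) = u z" if "z \<in> S" for z
  proof -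
    have "(\<Sum>i\<in>F. (?D z (w z) \<bullet> i) *\<^sub>R i) = (\<Sum>i\<in>F. (u z \<bullet> i) *\<^sub>R i)"
      using gw[OF that] g[OF that] by (intro sum.cong) auto
    then show ?thesis by (simp add: orthonormal_basis_expand[OF F])
  qed
  moreover have "w z = 0" if "z \<in> S" "u z = 0" for z
  proof -
    have "w z \<bullet> w z = (\<Sum>j\<in>F. a j z * (g j z \<bullet> w z))" by (subst (1) w_def) (simp add: inner_sum_left)
    also have "\<dots> = 0" using gw[OF that(1)] that(2) by (intro sum.neutral) auto
    finally show ?thesis by simp
  qed
  ultimately show ?thesis using sw by blast
qed

section \<open>Alternating forms\<close>

lemma alt1_UNIV_linear: "alt1 UNIV \<theta> \<Longrightarrow> linear \<theta>"
  by (auto simp: alt1_def intro!: linearI)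

lemma alt2_linear:
  assumes "alt2 UNIV \<eta>" shows "linear (\<eta> u)" "linear (\<lambda>v. \<eta> v u)"
  using assms by (auto simp: alt2_def intro: alt1_UNIV_linear)

lemma alt2_swap: assumes "alt2 UNIV \<eta>" shows "\<eta> u v = - \<eta> v u"
proof -
  have "\<eta> (u + v) (u + v) = 0" "\<eta> u u = 0" "\<eta> v v = 0" using assms by (auto simp: alt2_def)
  then show ?thesis
    by (simp add: linear_add[OF alt2_linear(1)[OF assms]] linear_add[OF alt2_linear(2)[OF assms]])
qed

lemma alt3_linear:
  assumes "alt3 UNIV \<phi>"
  shows "linear (\<lambda>x. \<phi> x v w)" "linear (\<lambda>x. \<phi> u x w)" "linear (\<lambda>x. \<phi> u v x)"
  using assms alt2_linear[of "\<phi> u"] by (auto simp: alt3_def intro: alt1_UNIV_linear)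

text \<open>\<open>contract2\<close> applies a bivector to the form with its last argument frozen;
  \<open>wedge\<close> would return its default value 0 if that form were not alternating.\<close>

lemma alt3_slot3: assumes "alt3 UNIV \<phi>" shows "alt2 UNIV (\<lambda>u v. \<phi> u v w)"
  using assms unfolding alt3_def alt2_def alt1_def by simp

lemma alt3_swap:
  assumes "alt3 UNIV \<phi>"
  shows "\<phi> u v w = - \<phi> v u w" "\<phi> u v w = - \<phi> u w v"
  using alt2_swap[OF alt3_slot3[OF assms], of u v] alt2_swap[of "\<phi> u" v w] assms
  by (auto simp: alt3_def)

lemma alt3_eq_0:
  assumes "alt3 UNIV \<phi>"
  shows "\<phi> u u w = 0" "\<phi> u w w = 0" "\<phi> u w u = 0"
proof -
  show a: "\<phi> u u w = 0" for u w using assms by (auto simp: alt3_def)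
  show "\<phi> u w w = 0" using assms by (auto simp: alt3_def alt2_def)
  show "\<phi> u w u = 0" using a[of u w] alt3_swap[OF assms, of u u w] by simp
qed

lemmas alt3_simps = alt3_linear[THEN linear_add] alt3_linear[THEN linear_diff]
  alt3_linear[THEN linear_scale] alt3_linear[THEN linear_neg] alt3_linear[THEN linear_0] alt3_eq_0

text \<open>Dependence is a notion for sets, while \<open>m\<close> is a family that may repeat a
  vector. In the case of a repetition the difference of the two members is the relation.\<close>

lemma linear_relation:
  fixes m :: "'i \<Rightarrow> 'e::real_vector"
  assumes "finite P" "finite B" "m ` P \<subseteq> span B" "card B < card P"
  shows "\<exists>c. (\<exists>p\<in>P. c p \<noteq> (0::real)) \<and> (\<Sum>p\<in>P. c p *\<^sub>R m p) = 0"
proof (cases "inj_on m P")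
  case True
  then have "card (m ` P) = card P" by (rule card_image)
  then have "dependent (m ` P)"
    using assms independent_span_bound[of B "m ` P"] by fastforce
  then obtain u where "\<exists>v\<in>m ` P. u v \<noteq> 0" "(\<Sum>v\<in>m ` P. u v *\<^sub>R v) = 0"
    using assms(1) dependent_finite[of "m ` P"] by auto
  then show ?thesis
    using True by (intro exI[of _ "u \<circ> m"]) (auto simp: sum.reindex)
next
  case False
  then obtain p q where pq: "p \<in> P" "q \<in> P" "p \<noteq> q" "m p = m q" by (auto simp: inj_on_def)
  let ?c = "\<lambda>x. if x = p then 1 else if x = q then -1 else (0::real)"
  have "(\<Sum>x\<in>P. ?c x *\<^sub>R m x) = (\<Sum>x\<in>{p, q}. ?c x *\<^sub>R m x)"
    using assms(1) pq by (intro sum.mono_neutral_right) auto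
  also have "\<dots> = 0" using pq by simp
  finally show ?thesis using pq by (intro exI[of _ ?c]) auto
qed

text \<open>
  If \<open>V\<close> has a basis with \<open>n \<ge> 4\<close> elements, the bivectors \<open>F\<^sub>0 \<and> Y\<close> and \<open>F\<^sub>1 \<and> Y\<close> with basis
  vectors \<open>Y\<close> span a space of dimension \<open>2n - 3 > n\<close>, so that one of them is annihilated by \<open>\<phi>\<close>.
\<close>

lemma card_independent_le_3:
  fixes \<phi> :: "'e::real_vector \<Rightarrow> 'e \<Rightarrow> 'e \<Rightarrow> real"
  assumes \<phi>: "alt3 UNIV \<phi>" and fin: "finite S" "span S = (UNIV::'e set)"
    and V: "subspace V"
    and ii: "\<And>b. b \<in> ext_square V \<Longrightarrow> (\<And>Z. Z \<in> V \<Longrightarrow> contract2 b \<phi> Z = 0) \<Longrightarrow> b = (\<lambda>_. 0)"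
    and C: "independent C" "C \<subseteq> V"
  shows "card C \<le> 3"
proof (rule ccontr)
  assume "\<not> card C \<le> 3"
  obtain B where B: "C \<subseteq> B" "B \<subseteq> V" "independent B" "V \<subseteq> span B"
    using maximal_independent_subset_extend[OF C(2,1)] by blast
  have fB: "finite B" using independent_span_bound[OF fin(1) B(3)] fin(2) by auto
  have card4: "card B \<ge> 4" using card_mono[OF fB B(1)] \<open>\<not> card C \<le> 3\<close> by linarith
  have "B \<noteq> {}" using card4 by auto
  then obtain F0 where F0: "F0 \<in> B" by blast
  have "card (B - {F0}) \<ge> 3" using card4 F0 fB by simp
  then have "B - {F0} \<noteq> {}" by (metis card.empty not_numeral_le_zero)
  then obtain F1 where "F1 \<in> B - {F0}" by blast
  then have F1: "F1 \<in> B" "F1 \<noteq> F0" by auto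
  \<comment> \<open>The pairs have n-1 and n-2 elements, together 2n-3, which exceeds n once n is at
    least 4. Omitting \<open>F0\<close> in the second part avoids listing the bivector of
    \<open>F0\<close> and \<open>F1\<close> twice.\<close>
  define P where "P = ({F0} \<times> (B - {F0})) \<union> ({F1} \<times> (B - {F0, F1}))"
  have fP: "finite P" by (simp add: P_def fB)
  have "card P = card ({F0} \<times> (B - {F0})) + card ({F1} \<times> (B - {F0, F1}))"
    unfolding P_def using F1 fB by (intro card_Un_disjoint) auto
  also have "\<dots> = (card B - 1) + (card B - 2)"
    using F0 F1 fB by (simp add: card_cartesian_product_singleton card_Diff_subset)
  finally have cP: "card B < card P" using card4 by linarith
  \<comment> \<open>\<open>m p\<close> encodes the contraction of \<phi> with the bivector
    \<open>p\<close>: its coordinates in \<open>B\<close> are the values on the basis. More such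
    vectors than basis elements must be dependent.\<close>
  define m where "m = (\<lambda>p. \<Sum>Z\<in>B. \<phi> (fst p) (snd p) Z *\<^sub>R Z)"
  have "\<exists>c. (\<exists>p\<in>P. c p \<noteq> (0::real)) \<and> (\<Sum>p\<in>P. c p *\<^sub>R m p) = 0"
    by (rule linear_relation[OF fP fB _ cP], unfold m_def)
      (intro image_subsetI span_sum span_scale span_base)
  then obtain c p0 where p0: "p0 \<in> P" "c p0 \<noteq> (0::real)" and c: "(\<Sum>p\<in>P. c p *\<^sub>R m p) = 0" by blast
  have "(\<Sum>p\<in>P. c p *\<^sub>R m p) = (\<Sum>Z\<in>B. (\<Sum>p\<in>P. c p * \<phi> (fst p) (snd p) Z) *\<^sub>R Z)"
    unfolding m_def scaleR_sum_right scaleR_sum_left scaleR_scaleR by (rule sum.swap)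
  then have cZ: "(\<Sum>p\<in>P. c p * \<phi> (fst p) (snd p) Z) = 0" if "Z \<in> B" for Z
    using independentD[OF B(3) fB order.refl, of "\<lambda>Z. \<Sum>p\<in>P. c p * \<phi> (fst p) (snd p) Z"] that c by simp
  have "linear (\<lambda>Z. \<Sum>p\<in>P. c p * \<phi> (fst p) (snd p) Z)"
    by (rule linearI) (simp_all add: alt3_simps[OF \<phi>] sum.distrib sum_distrib_left algebra_simps)
  then have cV: "(\<Sum>p\<in>P. c p * \<phi> (fst p) (snd p) Z) = 0" if "Z \<in> V" for Z
    using linear_eq_0_on_span[of "\<lambda>Z. \<Sum>p\<in>P. c p * \<phi> (fst p) (snd p) Z" B Z] cZ that B(4) by blast
  obtain e where e: "bij_betw e {..<card P} P"
    using ex_bij_betw_nat_finite[OF fP] by (auto simp: atLeast0LessThan)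
  \<comment> \<open>The relation as a bivector. Its scalars are absorbed into the first factors, and
    \<open>e\<close> enumerates \<open>P\<close> because \<open>ext_square\<close> sums over an
    initial segment of the naturals.\<close>
  define b where "b = (\<lambda>\<eta>. \<Sum>i<card P. wedge (c (e i) *\<^sub>R fst (e i)) (snd (e i)) \<eta>)"
  have b_alt: "b \<eta> = (\<Sum>p\<in>P. c p * \<eta> (fst p) (snd p))" if "alt2 UNIV \<eta>" for \<eta>
  proof -
    have "b \<eta> = (\<Sum>i<card P. c (e i) * \<eta> (fst (e i)) (snd (e i)))"
      unfolding b_def wedge_def using that by (simp add: linear_scale[OF alt2_linear(2)[OF that]])
    also have "\<dots> = (\<Sum>p\<in>P. c p * \<eta> (fst p) (snd p))"
      using sum.reindex_bij_betw[OF e] by (rule trans[rotated]) simp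
    finally show ?thesis .
  qed
  have PV: "fst p \<in> V" "snd p \<in> V" if "p \<in> P" for p
    using that B(2) F0 F1 by (auto simp: P_def)
  have "e i \<in> P" if "i < card P" for i using e that by (auto simp: bij_betw_def)
  then have eV: "fst (e i) \<in> V" "snd (e i) \<in> V" if "i < card P" for i using PV that by blast+
  have "b \<in> ext_square V"
    unfolding ext_square_def b_def
    by (intro CollectI exI conjI, rule refl) (use eV in \<open>simp add: subspace_scale[OF V]\<close>)
  moreover have "contract2 b \<phi> Z = 0" if "Z \<in> V" for Z
    unfolding contract2_def using b_alt[OF alt3_slot3[OF \<phi>]] cV[OF that] by simp
  ultimately have b0: "b = (\<lambda>_. 0)" by (rule ii)
  define q where "q = fst p0" define r where "r = snd p0"
  have qr: "q \<in> B" "r \<in> B" "q \<noteq> r" "p0 = (q, r)" using p0(1) F0 F1 by (auto simp: P_def q_def r_def)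
  \<comment> \<open>\<open>P\<close> never contains a pair in both orders, so no second term of the
    sum involves the bivector of \<open>q\<close> and \<open>r\<close>.\<close>
  have nrq: "(r, q) \<notin> P" using p0(1) unfolding qr(4) by (auto simp: P_def)
  obtain \<alpha> where \<alpha>: "linear \<alpha>" "\<And>x. x \<in> B \<Longrightarrow> \<alpha> x = (if x = q then 1 else (0::real))"
    using linear_independent_extend[OF B(3), of "\<lambda>x. if x = q then 1 else (0::real)"] by auto
  obtain \<beta> where \<beta>: "linear \<beta>" "\<And>x. x \<in> B \<Longrightarrow> \<beta> x = (if x = r then 1 else (0::real))"
    using linear_independent_extend[OF B(3), of "\<lambda>x. if x = r then 1 else (0::real)"] by auto
  \<comment> \<open>The wedge of two dual basis functionals detects the coefficient of
    \<open>p0\<close> in \<open>b\<close>, which is nonzero by choice.\<close>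
  define \<eta> where "\<eta> = (\<lambda>x y. \<alpha> x * \<beta> y - \<alpha> y * \<beta> x)"
  have \<eta>: "alt2 UNIV \<eta>"
    using \<alpha>(1) \<beta>(1) unfolding alt2_def alt1_def \<eta>_def
    by (simp add: linear_add linear_scale algebra_simps)
  have "c p * \<eta> (fst p) (snd p) = 0" if "p \<in> P - {p0}" for p
  proof -
    have "fst p \<in> B" "snd p \<in> B" using that F0 F1 by (auto simp: P_def)
    moreover have "p \<noteq> (q, r)" "p \<noteq> (r, q)" using that nrq qr(4) by auto
    ultimately show ?thesis using \<alpha>(2) \<beta>(2) by (auto simp: \<eta>_def prod_eq_iff)
  qed
  then have "(\<Sum>p\<in>P - {p0}. c p * \<eta> (fst p) (snd p)) = 0" by (rule sum.neutral[OF ballI])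
  then have "b \<eta> = c p0 * \<eta> q r"
    unfolding b_alt[OF \<eta>] using sum.remove[OF fP p0(1), of "\<lambda>p. c p * \<eta> (fst p) (snd p)"]
    by (simp add: q_def r_def)
  moreover have "\<eta> q r = 1" using \<alpha>(2) \<beta>(2) qr by (auto simp: \<eta>_def)
  ultimately show False using b0 p0(2) by simp
qed

text \<open>An alternating form vanishes on dependent vectors, so the triple is independent. An
  element of \<open>V\<close> outside its span would give four independent vectors.\<close>

lemma subset_span_of_alt3_neq_0:
  fixes \<phi> :: "'e::real_vector \<Rightarrow> 'e \<Rightarrow> 'e \<Rightarrow> real"
  assumes \<phi>: "alt3 UNIV \<phi>" and c3: "\<And>C. independent C \<Longrightarrow> C \<subseteq> V \<Longrightarrow> card C \<le> 3"
    and F: "F1 \<in> V" "F2 \<in> V" "F3 \<in> V" "\<phi> F1 F2 F3 \<noteq> 0"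
  shows "V \<subseteq> span {F1, F2, F3}"
proof
  fix Y assume "Y \<in> V"
  note s = alt3_simps[OF \<phi>]
  have 3: "F3 \<noteq> 0" using F(4) s by auto
  have 2: "F2 \<notin> span {F3}" using F(4) s by (auto simp: span_singleton)
  have 1: "F1 \<notin> span {F2, F3}"
  proof
    assume "F1 \<in> span {F2, F3}"
    then obtain k l where "F1 - k *\<^sub>R F2 = l *\<^sub>R F3"
      by (auto simp: span_breakdown_eq span_singleton)
    then have "F1 = k *\<^sub>R F2 + l *\<^sub>R F3" by (simp add: algebra_simps)
    then show False using F(4) s by simp
  qed
  have ind: "independent {F1, F2, F3}" and d: "F1 \<noteq> F2" "F1 \<noteq> F3" "F2 \<noteq> F3"
    using 1 2 3 by (auto simp: independent_insert span_base)
  show "Y \<in> span {F1, F2, F3}"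
  proof (rule ccontr)
    assume Y: "Y \<notin> span {F1, F2, F3}"
    then have "Y \<notin> {F1, F2, F3}" using span_superset[of "{F1, F2, F3}"] by blast
    moreover have "independent (insert Y {F1, F2, F3})"
      by (rule independent_insertI[OF Y ind])
    then have "card (insert Y {F1, F2, F3}) \<le> 3" using F \<open>Y \<in> V\<close> by (intro c3) auto
    moreover have "card (insert Y {F1, F2, F3}) = 4" using d \<open>Y \<notin> {F1, F2, F3}\<close> by simp
    ultimately show False by simp
  qed
qed

text \<open>The coefficients come from Cramer's rule: they make the combination of the
  \<open>F\<close>s agree with \<open>w\<close> when contracted against each of the three pairs of
  basis vectors. Those pairs determine the contraction on the whole span.\<close>

lemma contraction_cramer:
  fixes \<phi> :: "'e::real_vector \<Rightarrow> 'e \<Rightarrow> 'e \<Rightarrow> real"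
  assumes \<phi>: "alt3 UNIV \<phi>" and "\<phi> F1 F2 F3 \<noteq> 0"
    and Y: "Y \<in> span {F1, F2, F3}" and Z: "Z \<in> span {F1, F2, F3}"
  defines "d \<equiv> \<phi> F1 F2 F3"
  shows "\<phi> (w - ((\<phi> w F2 F3 / d) *\<^sub>R F1 + (\<phi> F1 w F3 / d) *\<^sub>R F2 + (\<phi> F1 F2 w / d) *\<^sub>R F3)) Y Z = 0"
proof -
  note s = alt3_simps[OF \<phi>]
  define v where "v = w - ((\<phi> w F2 F3 / d) *\<^sub>R F1 + (\<phi> F1 w F3 / d) *\<^sub>R F2 + (\<phi> F1 F2 w / d) *\<^sub>R F3)"
  have d0: "d \<noteq> 0" using assms by simp
  have 1: "\<phi> v F2 F3 = 0" using d0 by (simp add: v_def s d_def[symmetric])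
  have "\<phi> F2 F1 F3 = - d" using alt3_swap(1)[OF \<phi>, of F2 F1 F3] by (simp add: d_def)
  then have 2: "\<phi> v F1 F3 = 0"
    using d0 alt3_swap(1)[OF \<phi>, of w F1 F3] by (simp add: v_def s)
  have "\<phi> F3 F1 F2 = d" "\<phi> w F1 F2 = \<phi> F1 F2 w"
    using alt3_swap(1)[OF \<phi>, of F3 F1 F2] alt3_swap(2)[OF \<phi>, of F1 F3 F2]
      alt3_swap(1)[OF \<phi>, of w F1 F2] alt3_swap(2)[OF \<phi>, of F1 w F2] by (simp_all add: d_def)
  then have 3: "\<phi> v F1 F2 = 0" using d0 by (simp add: v_def s)
  note r = 1 2 3 alt3_swap(2)[OF \<phi>, of v F2 F1] alt3_swap(2)[OF \<phi>, of v F3 F1]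
    alt3_swap(2)[OF \<phi>, of v F3 F2]
  have span3: "\<exists>a b c. X = a *\<^sub>R F1 + b *\<^sub>R F2 + c *\<^sub>R F3" if X: "X \<in> span {F1, F2, F3}" for X
  proof -
    obtain a where "X - a *\<^sub>R F1 \<in> span {F2, F3}" using X span_breakdown_eq by blast
    then obtain b c where "X - a *\<^sub>R F1 - b *\<^sub>R F2 = c *\<^sub>R F3"
      by (auto simp: span_breakdown_eq span_singleton)
    then show ?thesis by (intro exI[of _ a] exI[of _ b] exI[of _ c]) (simp add: algebra_simps)
  qed
  obtain a b c where Y': "Y = a *\<^sub>R F1 + b *\<^sub>R F2 + c *\<^sub>R F3" using span3[OF Y] by blast
  obtain a' b' c' where Z': "Z = a' *\<^sub>R F1 + b' *\<^sub>R F2 + c' *\<^sub>R F3" using span3[OF Z] by blast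
  have "\<phi> v Y Z = 0" using r by (simp add: Y' Z' s)
  then show ?thesis by (simp add: v_def)
qed

section \<open>Charts\<close>

text \<open>The factorisation is asked for only near \<open>z\<close>, since a chart and its inverse
  cancel only on overlaps.\<close>

lemma frechet_derivative_comp_eq:
  assumes "open S" "z \<in> S" "f differentiable at z" "g differentiable at (f z)"
    "\<And>y. y \<in> S \<Longrightarrow> h y = g (f y)"
  shows "frechet_derivative h (at z) v = frechet_derivative g (at (f z)) (frechet_derivative f (at z) v)"
proof -
  have "((\<lambda>y. g (f y)) has_derivative
      (\<lambda>v. frechet_derivative g (at (f z)) (frechet_derivative f (at z) v))) (at z)"
    by (rule has_derivative_compose[where g = g and f = f])
      (use assms in \<open>auto simp: frechet_derivative_works[symmetric]\<close>)
  then have "(h has_derivative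
      (\<lambda>v. frechet_derivative g (at (f z)) (frechet_derivative f (at z) v))) (at z)"
    by (rule has_derivative_transform_within_open[OF _ assms(1,2)]) (simp add: assms(5))
  from frechet_derivative_at[OF this] show ?thesis by (simp add: fun_eq_iff)
qed

text \<open>Both functions have the same derivatives at \<open>z\<close>, possibly none, so the
  choice in \<open>frechet_derivative\<close> selects the same map.\<close>

lemma frechet_derivative_cong_open:
  assumes "open S" "z \<in> S" "\<And>y. y \<in> S \<Longrightarrow> f y = g y"
  shows "frechet_derivative f (at z) = frechet_derivative g (at z)"
proof -
  have "(f has_derivative D) (at z) \<longleftrightarrow> (g has_derivative D) (at z)" for D
    using has_derivative_transform_within_open[OF _ assms(1,2), of f D UNIV g]
      has_derivative_transform_within_open[OF _ assms(1,2), of g D UNIV f] assms(3) by auto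
  then show ?thesis by (simp add: frechet_derivative_def)
qed

text \<open>The product rule for a field pushed forward by \<open>P\<close>. Its second-derivative
  term is the one that cancels in a Lie bracket.\<close>

lemma derivative_of_derivative_apply:
  fixes X :: "'e::real_inner \<Rightarrow> 'e" and P :: "'e \<Rightarrow> 'f::real_inner"
  assumes E: "orthonormal_basis (E::'e set)" and "open S" "smooth_on S P" "smooth_on S X" "z \<in> S"
  shows "frechet_derivative (\<lambda>y. frechet_derivative P (at y) (X y)) (at z) w =
    frechet_derivative (\<lambda>y. frechet_derivative P (at y) (X z)) (at z) w +
    frechet_derivative P (at z) (frechet_derivative X (at z) w)"
proof -
  let ?D = "\<lambda>y. frechet_derivative P (at y)"
  let ?H = "\<lambda>b. frechet_derivative (\<lambda>y. ?D y b) (at z)"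
  have lin: "linear (?D y)" if "y \<in> S" for y
    using assms(3) that by (intro linear_frechet_derivative smooth_on_differentiable)
  have dX: "(X has_derivative frechet_derivative X (at z)) (at z)"
    using smooth_on_differentiable[OF assms(4,5)] by (simp add: frechet_derivative_works[symmetric])
  have dP: "((\<lambda>y. ?D y b) has_derivative ?H b) (at z)" for b
    using smooth_on_differentiable[OF smooth_on_derivative[OF assms(3)] assms(5)]
    by (simp add: frechet_derivative_works[symmetric])
  have "((\<lambda>y. \<Sum>b\<in>E. (X y \<bullet> b) *\<^sub>R ?D y b) has_derivative
      (\<lambda>w. \<Sum>b\<in>E. (X z \<bullet> b) *\<^sub>R ?H b w + (frechet_derivative X (at z) w \<bullet> b) *\<^sub>R ?D z b)) (at z)"
    by (intro has_derivative_sum has_derivative_scaleR has_derivative_inner_left dX dP)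
  moreover have "(\<Sum>b\<in>E. (X y \<bullet> b) *\<^sub>R ?D y b) = ?D y (X y)" if "y \<in> S" for y
    by (rule linear_orthonormal_basis[OF E lin[OF that], symmetric])
  ultimately have "((\<lambda>y. ?D y (X y)) has_derivative
      (\<lambda>w. \<Sum>b\<in>E. (X z \<bullet> b) *\<^sub>R ?H b w + (frechet_derivative X (at z) w \<bullet> b) *\<^sub>R ?D z b)) (at z)"
    by (rule has_derivative_transform_within_open[OF _ assms(2,5)])
  from frechet_derivative_at[OF this]
  have "frechet_derivative (\<lambda>y. ?D y (X y)) (at z) w =
      (\<Sum>b\<in>E. (X z \<bullet> b) *\<^sub>R ?H b w) + (\<Sum>b\<in>E. (frechet_derivative X (at z) w \<bullet> b) *\<^sub>R ?D z b)"
    by (simp add: fun_eq_iff sum.distrib)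
  also have "(\<Sum>b\<in>E. (frechet_derivative X (at z) w \<bullet> b) *\<^sub>R ?D z b) = ?D z (frechet_derivative X (at z) w)"
    by (rule linear_orthonormal_basis[OF E lin[OF assms(5)], symmetric])
  \<comment> \<open>\<open>?H b w\<close> is known to be linear in \<open>w\<close>, as a
    derivative, but not directly in \<open>b\<close>. Symmetry swaps the arguments, the expansion is
    collapsed, and symmetry swaps them back.\<close>
  also have "(\<Sum>b\<in>E. (X z \<bullet> b) *\<^sub>R ?H b w) = (\<Sum>b\<in>E. (X z \<bullet> b) *\<^sub>R ?H w b)"
    by (simp only: second_derivative_symmetric[OF assms(2,3,5), of _ w])
  also have "\<dots> = ?H w (X z)"
    by (rule linear_orthonormal_basis[OF E has_derivative_linear[OF dP], symmetric])
  also have "\<dots> = ?H (X z) w" by (rule second_derivative_symmetric[OF assms(2,3,5)])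
  finally show ?thesis .
qed

section \<open>Transition maps and coordinates of tangent vectors\<close>

locale manifold =
  fixes A :: "('m::{t2_space, second_countable_topology}, 'e::real_inner) atlas"
  assumes smooth_manifold: "smooth_manifold A"
begin

lemma orthonormal_basis_exists: "\<exists>E::'e set. orthonormal_basis E"
  using smooth_manifold ex_orthonormal_basis by (auto simp: smooth_manifold_def)

lemma open_chart_dom: "c \<in> A \<Longrightarrow> open (chart_dom c)"
  using smooth_manifold by (auto simp: smooth_manifold_def)

lemma chart_homeomorphism:
  "c \<in> A \<Longrightarrow> homeomorphism (chart_dom c) (chart_map c ` chart_dom c) (chart_map c) (chart_inv c)"
  using smooth_manifold by (auto simp: smooth_manifold_def)

lemma chart_inv_map: "c \<in> A \<Longrightarrow> x \<in> chart_dom c \<Longrightarrow> chart_inv c (chart_map c x) = x"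
  using homeomorphism_apply1[OF chart_homeomorphism] by blast

lemma continuous_on_chart_map: "c \<in> A \<Longrightarrow> continuous_on (chart_dom c) (chart_map c)"
  using chart_homeomorphism by (auto simp: homeomorphism_def)

lemma chart_at: "chart_at A x \<in> A" "x \<in> chart_dom (chart_at A x)"
proof -
  have "x \<in> (\<Union>c\<in>A. chart_dom c)" using smooth_manifold by (auto simp: smooth_manifold_def)
  then have "\<exists>c. c \<in> A \<and> x \<in> chart_dom c" by blast
  from someI_ex[OF this] show "chart_at A x \<in> A" "x \<in> chart_dom (chart_at A x)"
    unfolding chart_at_def by auto
qed

lemma open_chart_image:
  assumes "c \<in> A" "open U" "U \<subseteq> chart_dom c"
  shows "open (chart_map c ` U)"
proof -
  have "open (chart_map c ` chart_dom c)" using smooth_manifold assms(1)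
    by (auto simp: smooth_manifold_def)
  then show ?thesis
    using homeomorphism_imp_open_map[OF chart_homeomorphism[OF assms(1)]] assms(2,3)
    by (metis (no_types, lifting) inf.absorb_iff2 openin_open openin_open_eq)
qed

lemma smooth_on_transition:
  "c \<in> A \<Longrightarrow> d \<in> A \<Longrightarrow>
    smooth_on (chart_map c ` (chart_dom c \<inter> chart_dom d)) (chart_map d \<circ> chart_inv c)"
  using smooth_manifold by (auto simp: smooth_manifold_def)

lemma transition_differentiable:
  assumes "c \<in> A" "d \<in> A" "x \<in> chart_dom c" "x \<in> chart_dom d"
  shows "(chart_map d \<circ> chart_inv c) differentiable at (chart_map c x)"
  by (rule smooth_on_differentiable[OF smooth_on_transition[OF assms(1,2)]]) (use assms in auto)

lemma transition_cocycle:
  assumes "a \<in> A" "c \<in> A" "d \<in> A" "x \<in> chart_dom a" "x \<in> chart_dom c" "x \<in> chart_dom d"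
  shows "frechet_derivative (chart_map d \<circ> chart_inv a) (at (chart_map a x)) v =
    frechet_derivative (chart_map d \<circ> chart_inv c) (at (chart_map c x))
      (frechet_derivative (chart_map c \<circ> chart_inv a) (at (chart_map a x)) v)"
proof -
  let ?S = "chart_map a ` (chart_dom a \<inter> chart_dom c)"
  have e: "(chart_map c \<circ> chart_inv a) (chart_map a x) = chart_map c x"
    by (simp add: chart_inv_map assms)
  have "frechet_derivative (chart_map d \<circ> chart_inv a) (at (chart_map a x)) v =
    frechet_derivative (chart_map d \<circ> chart_inv c) (at ((chart_map c \<circ> chart_inv a) (chart_map a x)))
      (frechet_derivative (chart_map c \<circ> chart_inv a) (at (chart_map a x)) v)"
  proof (rule frechet_derivative_comp_eq)
    show "open ?S" by (intro open_chart_image assms open_Int open_chart_dom) auto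
    show "chart_map a x \<in> ?S" using assms by auto
    show "(chart_map d \<circ> chart_inv a) y = (chart_map d \<circ> chart_inv c) ((chart_map c \<circ> chart_inv a) y)"
      if "y \<in> ?S" for y using that by (auto simp: chart_inv_map assms)
    show "(chart_map c \<circ> chart_inv a) differentiable at (chart_map a x)"
      by (rule transition_differentiable assms)+
    show "(chart_map d \<circ> chart_inv c) differentiable at ((chart_map c \<circ> chart_inv a) (chart_map a x))"
      unfolding e by (rule transition_differentiable assms)+
  qed
  then show ?thesis by (simp only: e)
qed

lemma transition_self:
  assumes "a \<in> A" "x \<in> chart_dom a"
  shows "frechet_derivative (chart_map a \<circ> chart_inv a) (at (chart_map a x)) v = v"
proof -
  have "frechet_derivative (chart_map a \<circ> chart_inv a) (at (chart_map a x)) =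
      frechet_derivative (\<lambda>z. z) (at (chart_map a x))"
    by (rule frechet_derivative_cong_open[of "chart_map a ` chart_dom a"])
      (use assms in \<open>auto simp: chart_inv_map intro!: open_chart_image open_chart_dom\<close>)
  then show ?thesis by simp
qed

lemma transition_inverse:
  assumes "c \<in> A" "d \<in> A" "x \<in> chart_dom c" "x \<in> chart_dom d"
  shows "frechet_derivative (chart_map d \<circ> chart_inv c) (at (chart_map c x))
      (frechet_derivative (chart_map c \<circ> chart_inv d) (at (chart_map d x)) v) = v"
  using transition_cocycle[of d c d x v] transition_self[of d x v] assms by simp

lemma tangent_coords_change:
  assumes "c \<in> A" "d \<in> A" "x \<in> chart_dom c" "x \<in> chart_dom d"
  shows "tangent_coords A d x v =
    frechet_derivative (chart_map d \<circ> chart_inv c) (at (chart_map c x)) (tangent_coords A c x v)"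
  unfolding tangent_coords_def coord_at_def using assms chart_at by (intro transition_cocycle) auto

lemma tangent_coords_chart_at: "tangent_coords A (chart_at A x) x v = v"
  unfolding tangent_coords_def coord_at_def by (intro transition_self chart_at)

lemma linear_tangent_coords: "c \<in> A \<Longrightarrow> x \<in> chart_dom c \<Longrightarrow> linear (tangent_coords A c x)"
  unfolding tangent_coords_def coord_at_def
  by (intro linear_frechet_derivative transition_differentiable chart_at)

text \<open>The inverse of \<open>tangent_coords A c x\<close>. It turns a coordinate field of one
  chart into the representation by the charts chosen at each point.\<close>

definition of_coords :: "('m, 'e) chart \<Rightarrow> 'm \<Rightarrow> 'e \<Rightarrow> 'e" where
  "of_coords c x = frechet_derivative (chart_map (chart_at A x) \<circ> chart_inv c) (at (chart_map c x))"

lemma tangent_coords_of_coords: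
  "c \<in> A \<Longrightarrow> x \<in> chart_dom c \<Longrightarrow> tangent_coords A c x (of_coords c x v) = v"
  unfolding tangent_coords_def coord_at_def of_coords_def by (intro transition_inverse chart_at)

lemma of_coords_tangent_coords:
  "c \<in> A \<Longrightarrow> x \<in> chart_dom c \<Longrightarrow> of_coords c x (tangent_coords A c x v) = v"
  unfolding tangent_coords_def coord_at_def of_coords_def by (intro transition_inverse chart_at)

section \<open>Smooth vector fields and functions\<close>

lemma field_coords_map:
  "c \<in> A \<Longrightarrow> x \<in> chart_dom c \<Longrightarrow> field_coords A c X (chart_map c x) = tangent_coords A c x (X x)"
  by (simp add: field_coords_def chart_inv_map)

text \<open>One chart covering \<open>W\<close> suffices: in any other chart the coordinates are the
  derivative of the transition map applied to the given ones.\<close>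

lemma smooth_field_on_chart:
  assumes "c \<in> A" "open W" "W \<subseteq> chart_dom c" "smooth_on (chart_map c ` W) (field_coords A c X)"
  shows "smooth_field_on A W X"
  unfolding smooth_field_on_def
proof
  fix d assume d: "d \<in> A"
  obtain E :: "'e set" where E: "orthonormal_basis E" using orthonormal_basis_exists by blast
  let ?S = "chart_map d ` (W \<inter> chart_dom d)" and ?T = "chart_map c ` (W \<inter> chart_dom d)"
  let ?g = "chart_map c \<circ> chart_inv d"
  have S: "open ?S" using assms d by (intro open_chart_image open_Int open_chart_dom) auto
  have T: "open ?T" using assms d by (intro open_chart_image open_Int open_chart_dom) auto
  have g: "?g ` ?S \<subseteq> ?T" using d by (auto simp: chart_inv_map)
  have sf: "smooth_on ?T (chart_map d \<circ> chart_inv c)"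
    by (rule smooth_on_mono[OF smooth_on_transition[OF assms(1) d]]) (use assms in auto)
  have sg: "smooth_on ?S ?g"
    by (rule smooth_on_mono[OF smooth_on_transition[OF d assms(1)]]) (use assms in auto)
  have sX: "smooth_on ?T (field_coords A c X)" by (rule smooth_on_mono[OF assms(4)]) auto
  have sw: "smooth_on ?S (\<lambda>z. field_coords A c X (?g z))"
    by (rule smooth_on_compose[OF E S T g sX sg])
  show "smooth_on ?S (field_coords A d X)"
  proof (rule smooth_on_cong[OF S _ smooth_on_derivative_apply[OF E S T g sf sg sw]])
    fix z assume "z \<in> ?S"
    then obtain x where x: "z = chart_map d x" "x \<in> W" "x \<in> chart_dom d" by auto
    have xc: "x \<in> chart_dom c" using x(2) assms(3) by auto
    have gz: "?g (chart_map d x) = chart_map c x" by (simp add: x chart_inv_map d)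
    show "frechet_derivative (chart_map d \<circ> chart_inv c) (at (?g z)) (field_coords A c X (?g z)) =
        field_coords A d X z"
      unfolding x(1) gz field_coords_map[OF assms(1) xc] field_coords_map[OF d x(3)]
      by (rule tangent_coords_change[symmetric, OF assms(1) d xc x(3)])
  qed
qed

lemma smooth_field_on_coords:
  "smooth_field_on A U X \<Longrightarrow> c \<in> A \<Longrightarrow> S \<subseteq> chart_map c ` (U \<inter> chart_dom c) \<Longrightarrow>
    smooth_on S (field_coords A c X)"
  unfolding smooth_field_on_def by (blast intro: smooth_on_mono)

lemma smooth_field_on_mono: "smooth_field_on A U X \<Longrightarrow> W \<subseteq> U \<Longrightarrow> smooth_field_on A W X"
  unfolding smooth_field_on_def by (blast intro: smooth_on_mono)

lemma smooth_field_on_cong: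
  assumes "open U" "smooth_field_on A U X" "\<And>x. x \<in> U \<Longrightarrow> X x = Y x"
  shows "smooth_field_on A U Y"
  unfolding smooth_field_on_def
proof
  fix c assume c: "c \<in> A"
  have o: "open (chart_map c ` (U \<inter> chart_dom c))"
    using c assms(1) by (intro open_chart_image open_Int open_chart_dom) auto
  have "smooth_on (chart_map c ` (U \<inter> chart_dom c)) (field_coords A c X)"
    using assms(2) c by (simp add: smooth_field_on_def)
  then show "smooth_on (chart_map c ` (U \<inter> chart_dom c)) (field_coords A c Y)"
    by (rule smooth_on_cong[OF o, rotated]) (use c assms(3) in \<open>auto simp: field_coords_map\<close>)
qed

lemma smooth_fun_on_cong:
  assumes "open U" "smooth_fun_on A U f" "\<And>x. x \<in> U \<Longrightarrow> f x = g x"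
  shows "smooth_fun_on A U g"
  unfolding smooth_fun_on_def
proof
  fix c assume c: "c \<in> A"
  have o: "open (chart_map c ` (U \<inter> chart_dom c))"
    using c assms(1) by (intro open_chart_image open_Int open_chart_dom) auto
  have "smooth_on (chart_map c ` (U \<inter> chart_dom c)) (f \<circ> chart_inv c)"
    using assms(2) c by (simp add: smooth_fun_on_def)
  then show "smooth_on (chart_map c ` (U \<inter> chart_dom c)) (g \<circ> chart_inv c)"
    by (rule smooth_on_cong[OF o, rotated]) (use c assms(3) in \<open>auto simp: chart_inv_map\<close>)
qed

lemma smooth_field_on_local:
  assumes "\<And>x. x \<in> U \<Longrightarrow> \<exists>W. open W \<and> x \<in> W \<and> smooth_field_on A W X"
  shows "smooth_field_on A U X"
  unfolding smooth_field_on_def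
proof (intro ballI smooth_on_local)
  fix c z assume c: "c \<in> A" and "z \<in> chart_map c ` (U \<inter> chart_dom c)"
  then obtain x where x: "z = chart_map c x" "x \<in> U" "x \<in> chart_dom c" by auto
  obtain W where W: "open W" "x \<in> W" "smooth_field_on A W X" using assms[OF x(2)] by blast
  show "\<exists>T. open T \<and> z \<in> T \<and> smooth_on T (field_coords A c X)"
  proof (intro exI conjI)
    show "open (chart_map c ` (W \<inter> chart_dom c))"
      using c W by (intro open_chart_image open_Int open_chart_dom) auto
    show "z \<in> chart_map c ` (W \<inter> chart_dom c)" using x W by auto
    show "smooth_on (chart_map c ` (W \<inter> chart_dom c)) (field_coords A c X)"
      using c W by (auto simp: smooth_field_on_def)
  qed
qed

lemma smooth_field_on_add:
  assumes "open U" "smooth_field_on A U X" "smooth_field_on A U Y"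
  shows "smooth_field_on A U (\<lambda>x. X x + Y x)"
  unfolding smooth_field_on_def
proof
  fix c assume c: "c \<in> A"
  have o: "open (chart_map c ` (U \<inter> chart_dom c))"
    using c assms(1) by (intro open_chart_image open_Int open_chart_dom) auto
  show "smooth_on (chart_map c ` (U \<inter> chart_dom c)) (field_coords A c (\<lambda>x. X x + Y x))"
    by (rule smooth_on_cong[OF o _ smooth_on_add[OF o smooth_field_on_coords[OF assms(2) c order.refl]
          smooth_field_on_coords[OF assms(3) c order.refl]]])
      (auto simp: field_coords_map c linear_add[OF linear_tangent_coords[OF c]])
qed

lemma smooth_field_on_scaleR:
  assumes "open U" "smooth_fun_on A U f" "smooth_field_on A U X"
  shows "smooth_field_on A U (\<lambda>x. f x *\<^sub>R X x)"
  unfolding smooth_field_on_def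
proof
  fix c assume c: "c \<in> A"
  have o: "open (chart_map c ` (U \<inter> chart_dom c))"
    using c assms(1) by (intro open_chart_image open_Int open_chart_dom) auto
  have "smooth_on (chart_map c ` (U \<inter> chart_dom c)) (f \<circ> chart_inv c)"
    using assms(2) c by (simp add: smooth_fun_on_def)
  from smooth_on_scaleR[OF o this smooth_field_on_coords[OF assms(3) c order.refl]]
  show "smooth_on (chart_map c ` (U \<inter> chart_dom c)) (field_coords A c (\<lambda>x. f x *\<^sub>R X x))"
    by (rule smooth_on_cong[OF o, rotated])
      (auto simp: field_coords_map c linear_scale[OF linear_tangent_coords[OF c]] chart_inv_map)
qed

lemma smooth_fun_on_const: "smooth_fun_on A U (\<lambda>x. r)"
  by (simp add: smooth_fun_on_def o_def smooth_on_const)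

lemma smooth_field_on_diff:
  assumes "open U" "smooth_field_on A U X" "smooth_field_on A U Y"
  shows "smooth_field_on A U (\<lambda>x. X x - Y x)"
  using smooth_field_on_add[OF assms(1,2) smooth_field_on_scaleR[OF assms(1) smooth_fun_on_const assms(3), of "-1"]]
  by simp

lemma smooth_fun_on_minus:
  assumes "open U" "smooth_fun_on A U f" shows "smooth_fun_on A U (\<lambda>x. - f x)"
  unfolding smooth_fun_on_def
proof
  fix c assume c: "c \<in> A"
  have o: "open (chart_map c ` (U \<inter> chart_dom c))"
    using c assms(1) by (intro open_chart_image open_Int open_chart_dom) auto
  show "smooth_on (chart_map c ` (U \<inter> chart_dom c)) ((\<lambda>x. - f x) \<circ> chart_inv c)"
    using smooth_on_minus[OF o, of "f \<circ> chart_inv c"] assms(2) c by (simp add: smooth_fun_on_def o_def)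
qed

lemma smooth_fun_on_divide:
  assumes "open U" "smooth_fun_on A U f" "smooth_fun_on A U g" "\<And>x. x \<in> U \<Longrightarrow> g x \<noteq> 0"
  shows "smooth_fun_on A U (\<lambda>x. f x / g x)"
  unfolding smooth_fun_on_def
proof
  fix c assume c: "c \<in> A"
  let ?S = "chart_map c ` (U \<inter> chart_dom c)"
  have o: "open ?S" using c assms(1) by (intro open_chart_image open_Int open_chart_dom) auto
  have "smooth_on ?S (f \<circ> chart_inv c)" "smooth_on ?S (g \<circ> chart_inv c)"
    using assms(2,3) c by (simp_all add: smooth_fun_on_def)
  moreover have "(g \<circ> chart_inv c) z \<noteq> 0" if "z \<in> ?S" for z
    using that assms(4) by (auto simp: chart_inv_map c)
  ultimately show "smooth_on ?S ((\<lambda>x. f x / g x) \<circ> chart_inv c)"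
    using smooth_on_divide[OF o, of "f \<circ> chart_inv c" "g \<circ> chart_inv c"] by (simp add: o_def)
qed

lemma smooth_fun_on_neq_0_open:
  assumes "open U" "smooth_fun_on A U f" "x \<in> U" "f x \<noteq> 0"
  shows "\<exists>W. open W \<and> x \<in> W \<and> W \<subseteq> U \<and> (\<forall>y\<in>W. f y \<noteq> 0)"
proof -
  let ?c = "chart_at A x"
  let ?S = "chart_map ?c ` (U \<inter> chart_dom ?c)"
  have o: "open ?S" using chart_at assms(1) by (intro open_chart_image open_Int open_chart_dom) auto
  have "continuous_on ?S (f \<circ> chart_inv ?c)"
    by (rule smooth_on_continuous) (use assms(2) chart_at in \<open>simp add: smooth_fun_on_def\<close>)
  then have T: "open ((f \<circ> chart_inv ?c) -` (- {0}) \<inter> ?S)" (is "open ?T")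
    by (rule continuous_on_open_vimage[OF o, THEN iffD1, rule_format]) auto
  have W: "open (chart_map ?c -` ?T \<inter> chart_dom ?c)" (is "open ?W")
    by (rule continuous_on_open_vimage[OF open_chart_dom[OF chart_at(1)], THEN iffD1, rule_format])
      (use continuous_on_chart_map[OF chart_at(1)] T in auto)
  have "open (?W \<inter> U)" using W assms(1) by auto
  moreover have "x \<in> ?W \<inter> U" using assms(3,4) chart_at[of x] by (auto simp: chart_inv_map)
  moreover have "f y \<noteq> 0" if "y \<in> ?W \<inter> U" for y
  proof -
    have "f (chart_inv ?c (chart_map ?c y)) \<noteq> 0" using that by simp
    then show ?thesis using that chart_at[of x] by (simp add: chart_inv_map)
  qed
  ultimately show ?thesis by blast
qed

lemma smooth_field_on_of_coords:
  assumes "c \<in> A" "open W" "W \<subseteq> chart_dom c" "smooth_on (chart_map c ` W) w"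
  shows "smooth_field_on A W (\<lambda>x. of_coords c x (w (chart_map c x)))"
proof (rule smooth_field_on_chart[OF assms(1-3)])
  have o: "open (chart_map c ` W)" using assms by (intro open_chart_image)
  show "smooth_on (chart_map c ` W) (field_coords A c (\<lambda>x. of_coords c x (w (chart_map c x))))"
    by (rule smooth_on_cong[OF o _ assms(4)])
      (use assms in \<open>auto simp: field_coords_map tangent_coords_of_coords subset_eq\<close>)
qed

section \<open>Directional derivatives and Lie brackets\<close>

lemma dir_deriv_eq:
  "dir_deriv A X f x = frechet_derivative (f \<circ> chart_inv (chart_at A x)) (at (coord_at A x)) (X x)"
proof -
  have "chart_at real_line t = (UNIV, \<lambda>t. t)" for t
    unfolding chart_at_def real_line_def by (rule some_equality) auto
  then show ?thesis by (simp add: dir_deriv_def tangent_map_def o_def)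
qed

lemma dir_deriv_cong:
  assumes "open U" "x \<in> U" "\<And>y. y \<in> U \<Longrightarrow> f y = g y"
  shows "dir_deriv A X f x = dir_deriv A X g x"
  unfolding dir_deriv_eq coord_at_def
  by (subst frechet_derivative_cong_open[of "chart_map (chart_at A x) ` (U \<inter> chart_dom (chart_at A x))" _ _ "g \<circ> chart_inv (chart_at A x)"])
    (use assms chart_at in \<open>auto simp: chart_inv_map intro!: open_chart_image open_Int open_chart_dom\<close>)

lemma dir_deriv_const: "dir_deriv A X (\<lambda>y. r) x = 0"
  unfolding dir_deriv_eq by (simp add: o_def)

lemma dir_deriv_minus:
  assumes "smooth_fun_on A U f" "x \<in> U"
  shows "dir_deriv A X (\<lambda>y. - f y) x = - dir_deriv A X f x"
proof -
  let ?c = "chart_at A x" and ?z = "coord_at A x"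
  have "(f \<circ> chart_inv ?c) differentiable at ?z"
    by (rule smooth_on_differentiable[of "chart_map ?c ` (U \<inter> chart_dom ?c)"])
      (use assms chart_at in \<open>auto simp: smooth_fun_on_def coord_at_def\<close>)
  then have "((\<lambda>y. - (f \<circ> chart_inv ?c) y) has_derivative
      (\<lambda>v. - frechet_derivative (f \<circ> chart_inv ?c) (at ?z) v)) (at ?z)"
    by (intro has_derivative_minus) (simp only: frechet_derivative_works o_def)
  from frechet_derivative_at[OF this] show ?thesis
    by (simp add: dir_deriv_eq o_def fun_eq_iff)
qed

lemma lie_bracket_eq:
  "lie_bracket A X Y x =
    frechet_derivative (field_coords A (chart_at A x) Y) (at (coord_at A x)) (X x) -
    frechet_derivative (field_coords A (chart_at A x) X) (at (coord_at A x)) (Y x)"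
  by (simp add: lie_bracket_def Let_def coord_at_def field_coords_map chart_at tangent_coords_chart_at)

end

section \<open>Submersions\<close>

locale submersion = M: manifold A + N: manifold B
  for A :: "('m::{t2_space, second_countable_topology}, 'e::real_inner) atlas"
    and B :: "('b::{t2_space, second_countable_topology}, 'f::real_inner) atlas" +
  fixes p :: "'m \<Rightarrow> 'b"
  assumes smooth_p: "smooth_map A B p" and surj_p: "\<And>x. surj (tangent_map A B p x)"
begin

abbreviation T :: "'m \<Rightarrow> 'e \<Rightarrow> 'f" where "T \<equiv> tangent_map A B p"
abbreviation V :: "'m \<Rightarrow> 'e set" where "V \<equiv> vertical A B p"

section \<open>The differential of the submersion in charts\<close>

lemma open_vimage_p: "open S \<Longrightarrow> open (p -` S)"
  using smooth_p by (simp add: smooth_map_def open_vimage)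

lemma smooth_on_p:
  "c \<in> A \<Longrightarrow> d \<in> B \<Longrightarrow>
    smooth_on (chart_map c ` (chart_dom c \<inter> p -` chart_dom d)) (chart_map d \<circ> p \<circ> chart_inv c)"
  using smooth_p by (auto simp: smooth_map_def)

lemma p_differentiable:
  assumes "c \<in> A" "d \<in> B" "x \<in> chart_dom c" "p x \<in> chart_dom d"
  shows "(chart_map d \<circ> p \<circ> chart_inv c) differentiable at (chart_map c x)"
  by (rule smooth_on_differentiable[OF smooth_on_p[OF assms(1,2)]]) (use assms in auto)

lemma linear_T: "linear (T x)"
  unfolding tangent_map_def coord_at_def
  by (intro linear_frechet_derivative p_differentiable M.chart_at N.chart_at)

lemma subspace_V: "subspace (V x)"
  unfolding vertical_def using linear_T by (simp add: subspace_def linear_add linear_scale linear_0)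

text \<open>Both sides are the derivative of one mixed representation of \<open>p\<close>, from the
  chart chosen at \<open>x\<close> to \<open>d\<close>. It is factored once through the chart chosen
  at \<open>p x\<close> and once through \<open>c\<close>.\<close>

lemma T_coords:
  assumes c: "c \<in> A" "x \<in> chart_dom c" and d: "d \<in> B" "p x \<in> chart_dom d"
  shows "tangent_coords B d (p x) (T x v) =
    frechet_derivative (chart_map d \<circ> p \<circ> chart_inv c) (at (chart_map c x)) (tangent_coords A c x v)"
proof -
  let ?a = "chart_at A x" and ?b = "chart_at B (p x)"
  let ?z = "chart_map ?a x"
  have eb: "(chart_map ?b \<circ> p \<circ> chart_inv ?a) ?z = chart_map ?b (p x)"
    and ec: "(chart_map c \<circ> chart_inv ?a) ?z = chart_map c x"
    by (simp_all add: M.chart_inv_map M.chart_at)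
  have "frechet_derivative (chart_map d \<circ> p \<circ> chart_inv ?a) (at ?z) v =
    frechet_derivative (chart_map d \<circ> chart_inv ?b) (at ((chart_map ?b \<circ> p \<circ> chart_inv ?a) ?z))
      (frechet_derivative (chart_map ?b \<circ> p \<circ> chart_inv ?a) (at ?z) v)"
  proof (rule frechet_derivative_comp_eq)
    let ?S = "chart_map ?a ` (chart_dom ?a \<inter> p -` (chart_dom ?b \<inter> chart_dom d))"
    show "open ?S" using d
      by (intro M.open_chart_image open_Int open_vimage_p M.open_chart_dom N.open_chart_dom
        M.chart_at N.chart_at) auto
    show "?z \<in> ?S" using d M.chart_at N.chart_at by auto
    show "(chart_map d \<circ> p \<circ> chart_inv ?a) y =
        (chart_map d \<circ> chart_inv ?b) ((chart_map ?b \<circ> p \<circ> chart_inv ?a) y)" if "y \<in> ?S" for y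
      using that by (auto simp: M.chart_inv_map N.chart_inv_map M.chart_at N.chart_at)
    show "(chart_map ?b \<circ> p \<circ> chart_inv ?a) differentiable at ?z"
      by (intro p_differentiable M.chart_at N.chart_at)
    show "(chart_map d \<circ> chart_inv ?b) differentiable at ((chart_map ?b \<circ> p \<circ> chart_inv ?a) ?z)"
      unfolding eb by (intro N.transition_differentiable N.chart_at d)
  qed
  moreover have "frechet_derivative (chart_map d \<circ> p \<circ> chart_inv ?a) (at ?z) v =
    frechet_derivative (chart_map d \<circ> p \<circ> chart_inv c) (at ((chart_map c \<circ> chart_inv ?a) ?z))
      (frechet_derivative (chart_map c \<circ> chart_inv ?a) (at ?z) v)"
  proof (rule frechet_derivative_comp_eq)
    let ?S = "chart_map ?a ` (chart_dom ?a \<inter> chart_dom c)"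
    show "open ?S" using c
      by (intro M.open_chart_image open_Int M.open_chart_dom M.chart_at) auto
    show "?z \<in> ?S" using c M.chart_at by auto
    show "(chart_map d \<circ> p \<circ> chart_inv ?a) y =
        (chart_map d \<circ> p \<circ> chart_inv c) ((chart_map c \<circ> chart_inv ?a) y)" if "y \<in> ?S" for y
      using that c by (auto simp: M.chart_inv_map M.chart_at)
    show "(chart_map c \<circ> chart_inv ?a) differentiable at ?z"
      by (intro M.transition_differentiable M.chart_at c)
    show "(chart_map d \<circ> p \<circ> chart_inv c) differentiable at ((chart_map c \<circ> chart_inv ?a) ?z)"
      unfolding ec by (intro p_differentiable c d)
  qed
  ultimately show ?thesis
    unfolding eb ec tangent_coords_def tangent_map_def coord_at_def by simp
qed

lemma surj_p_coords:
  assumes c: "c \<in> A" "x \<in> chart_dom c" and d: "d \<in> B" "p x \<in> chart_dom d"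
  shows "surj (frechet_derivative (chart_map d \<circ> p \<circ> chart_inv c) (at (chart_map c x)))"
proof (rule surjI)
  fix w
  show "frechet_derivative (chart_map d \<circ> p \<circ> chart_inv c) (at (chart_map c x))
      (tangent_coords A c x (inv (T x) (N.of_coords d (p x) w))) = w"
    unfolding T_coords[OF c d, symmetric] surj_f_inv_f[OF surj_p]
      by (rule N.tangent_coords_of_coords[OF d])
qed

text \<open>Brackets of \<open>p\<close>-related fields are \<open>p\<close>-related:
  differentiating the relation in charts produces second derivatives of \<open>p\<close>, which are
  symmetric and cancel.\<close>

lemma T_bracket:
  assumes U: "open U" "smooth_field_on A U X" "smooth_field_on A U Y" "x \<in> U"
    and W: "open W" "smooth_field_on B W u" "smooth_field_on B W v" "p ` U \<subseteq> W"
    and Xu: "\<And>y. y \<in> U \<Longrightarrow> T y (X y) = u (p y)" and Yv: "\<And>y. y \<in> U \<Longrightarrow> T y (Y y) = v (p y)"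
  shows "T x (lie_bracket A X Y x) = lie_bracket B u v (p x)"
proof -
  obtain E :: "'e set" where E: "orthonormal_basis E" using M.orthonormal_basis_exists by blast
  define c where "c = chart_at A x"
  define d where "d = chart_at B (p x)"
  define P where "P = chart_map d \<circ> p \<circ> chart_inv c"
  define z where "z = chart_map c x"
  have c: "c \<in> A" "x \<in> chart_dom c" and d: "d \<in> B" "p x \<in> chart_dom d"
    by (simp_all add: c_def d_def M.chart_at N.chart_at)
  let ?U = "U \<inter> chart_dom c \<inter> p -` chart_dom d"
  let ?S = "chart_map c ` ?U"
  let ?fX = "field_coords A c X" and ?fY = "field_coords A c Y"
  let ?fu = "field_coords B d u" and ?fv = "field_coords B d v"
  let ?D = "\<lambda>y. frechet_derivative P (at y)"
  have S: "open ?S"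
    using c d U by (intro M.open_chart_image open_Int open_vimage_p M.open_chart_dom N.open_chart_dom) auto
  have zS: "z \<in> ?S" using c d U by (auto simp: z_def)
  have sP: "smooth_on ?S P" unfolding P_def by (rule smooth_on_mono[OF smooth_on_p[OF c(1) d(1)]]) auto
  have Pz: "P z = chart_map d (p x)" by (simp add: P_def z_def M.chart_inv_map c)
  \<comment> \<open>The identity DP(Z) = r(P), differentiated in direction \<open>w\<close> with the
    left side expanded by the product rule.\<close>
  have rel: "frechet_derivative (\<lambda>y. ?D y (Z z)) (at z) w + ?D z (frechet_derivative Z (at z) w) =
      frechet_derivative r (at (P z)) (?D z w)"
    if "Z = field_coords A c Z'" "r = field_coords B d r'"
      "smooth_field_on A U Z'" "smooth_field_on B W r'"
      "\<And>y. y \<in> U \<Longrightarrow> T y (Z' y) = r' (p y)" for Z Z' r r' w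
  proof -
    have sZ: "smooth_on ?S Z" unfolding that(1) by (rule M.smooth_field_on_coords[OF that(3) c(1)]) auto
    have "smooth_on (chart_map d ` (W \<inter> chart_dom d)) r" unfolding that(2)
      by (rule N.smooth_field_on_coords[OF that(4) d(1)]) auto
    moreover have "P z \<in> chart_map d ` (W \<inter> chart_dom d)" unfolding Pz using d W(4) U(4) by auto
    ultimately have dr: "r differentiable at (P z)" by (rule smooth_on_differentiable)
    have "frechet_derivative (\<lambda>y. ?D y (Z y)) (at z) w = frechet_derivative r (at (P z)) (?D z w)"
    proof (rule frechet_derivative_comp_eq[OF S zS smooth_on_differentiable[OF sP zS] dr])
      fix y assume "y \<in> ?S"
      then obtain m where m: "y = chart_map c m" "m \<in> U" "m \<in> chart_dom c" "p m \<in> chart_dom d" by auto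
      have "?D y (Z y) = tangent_coords B d (p m) (T m (Z' m))"
        unfolding m(1) that(1) P_def M.field_coords_map[OF c(1) m(3)]
          by (rule T_coords[OF c(1) m(3) d(1) m(4), symmetric])
      also have "\<dots> = r (chart_map d (p m))"
        unfolding that(2) N.field_coords_map[OF d(1) m(4)] that(5)[OF m(2)] ..
      also have "chart_map d (p m) = P y" by (simp add: P_def m M.chart_inv_map c)
      finally show "?D y (Z y) = r (P y)" .
    qed
    then show ?thesis unfolding derivative_of_derivative_apply[OF E S sP sZ zS] .
  qed
  have X: "?fX z = X x" and Y: "?fY z = Y x"
    by (simp_all add: z_def M.field_coords_map c) (simp_all add: c_def M.tangent_coords_chart_at)
  have uv: "?D z (X x) = u (p x)" "?D z (Y x) = v (p x)"
    using T_coords[OF c d, of "X x"] T_coords[OF c d, of "Y x"] Xu[OF U(4)] Yv[OF U(4)]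
    unfolding P_def z_def by (simp_all add: c_def d_def M.tangent_coords_chart_at N.tangent_coords_chart_at)
  \<comment> \<open>Each relation is evaluated on the value of the other field, so that the
    second-derivative terms become equal by symmetry.\<close>
  note 1 = rel[OF refl refl U(2) W(2) Xu, of "Y x"] and 2 = rel[OF refl refl U(3) W(3) Yv, of "X x"]
  have lin: "linear (?D z)" by (intro linear_frechet_derivative smooth_on_differentiable[OF sP zS])
  have "T x (lie_bracket A X Y x) = ?D z (lie_bracket A X Y x)"
    using T_coords[OF c d, of "lie_bracket A X Y x"]
    unfolding P_def z_def by (simp add: c_def d_def M.tangent_coords_chart_at N.tangent_coords_chart_at)
  also have "\<dots> = ?D z (frechet_derivative ?fY (at z) (X x)) - ?D z (frechet_derivative ?fX (at z) (Y x))"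
    unfolding M.lie_bracket_eq coord_at_def c_def[symmetric] z_def[symmetric] linear_diff[OF lin] ..
  also have "\<dots> = frechet_derivative ?fv (at (P z)) (u (p x)) - frechet_derivative ?fu (at (P z)) (v (p x))"
    using 1[unfolded X uv] 2[unfolded Y uv] second_derivative_symmetric[OF S sP zS, of "X x" "Y x"]
    by (metis add_diff_cancel_left)
  also have "\<dots> = lie_bracket B u v (p x)"
    unfolding N.lie_bracket_eq coord_at_def d_def[symmetric] Pz ..
  finally show ?thesis .
qed

text \<open>A smooth right inverse of the differential in one pair of charts. The lift is not yet
  horizontal; its vertical part is removed later.\<close>

lemma local_lift:
  assumes N: "open N" "smooth_field_on B N u" "p x0 \<in> N"
  shows "\<exists>W X. open W \<and> x0 \<in> W \<and> p ` W \<subseteq> N \<and> smooth_field_on A W X \<and> (\<forall>y\<in>W. T y (X y) = u (p y))"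
proof -
  obtain E :: "'e set" where E: "orthonormal_basis E" using M.orthonormal_basis_exists by blast
  obtain F :: "'f set" where F: "orthonormal_basis F" using N.orthonormal_basis_exists by blast
  define c where "c = chart_at A x0"
  define d where "d = chart_at B (p x0)"
  define P where "P = chart_map d \<circ> p \<circ> chart_inv c"
  have c: "c \<in> A" "x0 \<in> chart_dom c" and d: "d \<in> B" "p x0 \<in> chart_dom d"
    by (simp_all add: c_def d_def M.chart_at N.chart_at)
  let ?W = "chart_dom c \<inter> p -` (N \<inter> chart_dom d)"
  let ?S = "chart_map c ` ?W" and ?R = "chart_map d ` (N \<inter> chart_dom d)"
  have W: "open ?W" using c d N by (intro open_Int open_vimage_p M.open_chart_dom N.open_chart_dom)
  have S: "open ?S" using c W by (intro M.open_chart_image) auto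
  have R: "open ?R" using d N by (intro N.open_chart_image open_Int N.open_chart_dom) auto
  have sP: "smooth_on ?S P" unfolding P_def by (rule smooth_on_mono[OF smooth_on_p[OF c(1) d(1)]]) auto
  have PR: "P ` ?S \<subseteq> ?R" using c by (auto simp: P_def M.chart_inv_map)
  have su: "smooth_on ?S (\<lambda>z. field_coords B d u (P z))"
    by (rule smooth_on_compose[OF F S R PR N.smooth_field_on_coords[OF N(2) d(1) order.refl] sP])
  have sur: "surj (frechet_derivative P (at z))" if "z \<in> ?S" for z
    using that surj_p_coords[OF c(1) _ d(1)] by (auto simp: P_def)
  obtain w where w: "smooth_on ?S w" "\<And>z. z \<in> ?S \<Longrightarrow>
      frechet_derivative P (at z) (w z) = field_coords B d u (P z)"
    using smooth_right_inverse[OF E F S sP sur su] by blast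
  have "T y (M.of_coords c y (w (chart_map c y))) = u (p y)" if "y \<in> ?W" for y
  proof -
    have y: "y \<in> chart_dom c" "p y \<in> chart_dom d" using that by auto
    have "tangent_coords B d (p y) (T y (M.of_coords c y (w (chart_map c y)))) =
        tangent_coords B d (p y) (u (p y))"
      unfolding T_coords[OF c(1) y(1) d(1) y(2)] M.tangent_coords_of_coords[OF c(1) y(1)]
      using w(2)[of "chart_map c y"] that
      by (auto simp: P_def M.chart_inv_map c N.field_coords_map d)
    then show ?thesis by (metis N.of_coords_tangent_coords[OF d(1) y(2)])
  qed
  moreover have "smooth_field_on A ?W (\<lambda>y. M.of_coords c y (w (chart_map c y)))"
    by (rule M.smooth_field_on_of_coords[OF c(1) W _ w(1)]) auto
  moreover have "x0 \<in> ?W" "p ` ?W \<subseteq> N" using c d N by auto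
  ultimately show ?thesis using W
    by (intro exI[of _ ?W] exI[of _ "\<lambda>y. M.of_coords c y (w (chart_map c y))"]) auto
qed

text \<open>From the field with constant coordinates, the least-norm solution with the same
  projection is subtracted. At \<open>x0\<close> the projection is 0, so nothing is subtracted there
  and the value \<open>v\<close> survives.\<close>

lemma local_vertical_extension:
  assumes v: "v \<in> V x0"
  shows "\<exists>W X. open W \<and> x0 \<in> W \<and> section_on A V W X \<and> X x0 = v"
proof -
  obtain E :: "'e set" where E: "orthonormal_basis E" using M.orthonormal_basis_exists by blast
  obtain F :: "'f set" where F: "orthonormal_basis F" using N.orthonormal_basis_exists by blast
  define c where "c = chart_at A x0"
  define d where "d = chart_at B (p x0)"
  define P where "P = chart_map d \<circ> p \<circ> chart_inv c"
  have c: "c \<in> A" "x0 \<in> chart_dom c" and d: "d \<in> B" "p x0 \<in> chart_dom d"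
    by (simp_all add: c_def d_def M.chart_at N.chart_at)
  let ?W = "chart_dom c \<inter> p -` chart_dom d"
  let ?S = "chart_map c ` ?W"
  let ?v = "tangent_coords A c x0 v"
  have W: "open ?W" using c d by (intro open_Int open_vimage_p M.open_chart_dom N.open_chart_dom)
  have S: "open ?S" using c W by (intro M.open_chart_image) auto
  have sP: "smooth_on ?S P" unfolding P_def by (rule smooth_on_p[OF c(1) d(1)])
  have sur: "surj (frechet_derivative P (at z))" if "z \<in> ?S" for z
    using that surj_p_coords[OF c(1) _ d(1)] by (auto simp: P_def)
  obtain w where w: "smooth_on ?S w"
    "\<And>z. z \<in> ?S \<Longrightarrow> frechet_derivative P (at z) (w z) = frechet_derivative P (at z) ?v"
    "\<And>z. z \<in> ?S \<Longrightarrow> frechet_derivative P (at z) ?v = 0 \<Longrightarrow> w z = 0"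
    using smooth_right_inverse[OF E F S sP sur smooth_on_derivative[OF sP, of ?v]] by blast
  let ?X = "\<lambda>y. M.of_coords c y (?v - w (chart_map c y))"
  have "T y (?X y) = 0" if "y \<in> ?W" for y
  proof -
    have y: "y \<in> chart_dom c" "p y \<in> chart_dom d" using that by auto
    have yS: "chart_map c y \<in> ?S" using y by auto
    have "linear (frechet_derivative P (at (chart_map c y)))"
      by (intro linear_frechet_derivative smooth_on_differentiable[OF sP yS])
    then have "tangent_coords B d (p y) (T y (?X y)) = 0"
      unfolding T_coords[OF c(1) y(1) d(1) y(2)] M.tangent_coords_of_coords[OF c(1) y(1)] P_def[symmetric]
      using w(2)[OF yS] by (simp add: linear_diff)
    then show ?thesis
      by (metis N.of_coords_tangent_coords[OF d(1) y(2)] linear_0[OF N.linear_tangent_coords[OF d(1) y(2)]])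
  qed
  moreover have "smooth_field_on A ?W ?X"
    by (rule M.smooth_field_on_of_coords[OF c(1) W _ smooth_on_diff[OF S smooth_on_const w(1)]]) auto
  moreover have x0: "x0 \<in> ?W" using c d by auto
  moreover have "?X x0 = v"
  proof -
    have "frechet_derivative P (at (chart_map c x0)) ?v = 0"
      unfolding P_def T_coords[OF c d, symmetric] using v linear_0[OF N.linear_tangent_coords[OF d]]
      by (simp add: vertical_def)
    then have "w (chart_map c x0) = 0" using w(3)[of "chart_map c x0"] x0 by auto
    then show ?thesis by (simp add: M.of_coords_tangent_coords c)
  qed
  ultimately show ?thesis using W unfolding section_on_def vertical_def
    by (intro exI[of _ ?W] exI[of _ ?X]) auto
qed

end

section \<open>The horizontal distribution of a fibrewise 2-plectic form\<close>

text \<open>A linear right inverse \<open>g\<close> is injective and carries a basis to equally many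
  independent vectors, which must span. So \<open>g\<close> is onto and \<open>f\<close> is its
  inverse.\<close>

lemma linear_surj_imp_inj_finite_span:
  fixes f :: "'e::real_vector \<Rightarrow> 'e"
  assumes "finite S" "span S = (UNIV::'e set)" "linear f" "surj f"
  shows "inj f"
proof -
  obtain B where B: "B \<subseteq> S" "independent B" "S \<subseteq> span B" using maximal_independent_subset[of S] by blast
  have fB: "finite B" using B assms finite_subset by blast
  have sB: "span B = UNIV" using B(3) assms(2) span_mono span_span by (metis top.extremum_uniqueI)
  obtain g where g: "linear g" "f \<circ> g = id"
    using linear_surjective_right_inverse[OF assms(3,4)] by blast
  have fg: "f (g y) = y" for y using g(2) by (metis comp_apply id_apply)
  have ig: "inj g" by (metis fg injI)
  have igB: "independent (g ` B)"
    by (rule linear_independent_injective_image[OF g(1) B(2)]) (rule inj_on_subset[OF ig], simp)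
  have cg: "card (g ` B) = card B" by (rule card_image, rule inj_on_subset[OF ig], simp)
  have "x \<in> span (g ` B)" for x
  proof (rule ccontr)
    assume x: "x \<notin> span (g ` B)"
    then have "x \<notin> g ` B" using span_superset[of "g ` B"] by blast
    then have "card (insert x (g ` B)) = Suc (card B)" using fB cg by simp
    moreover have "card (insert x (g ` B)) \<le> card B"
      using independent_span_bound[OF fB independent_insertI[OF x igB]] sB by simp
    ultimately show False by simp
  qed
  then have "surj g" using linear_span_image[OF g(1), of B] sB by auto
  then show ?thesis by (metis fg injI surjD)
qed

context manifold begin

lemma smooth_field_on_0:
  "open U \<Longrightarrow> smooth_field_on A U X \<Longrightarrow> smooth_field_on A U (\<lambda>x. 0)"
  using smooth_field_on_scaleR[OF _ smooth_fun_on_const, of U X 0] by simp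

lemma smooth_field_on_0_UNIV: "smooth_field_on A UNIV (\<lambda>x. 0)"
proof (rule smooth_field_on_local)
  fix x
  let ?c = "chart_at A x"
  have "smooth_field_on A (chart_dom ?c) (\<lambda>x. of_coords ?c x ((\<lambda>_. 0) (chart_map ?c x)))"
    by (rule smooth_field_on_of_coords[OF chart_at(1) open_chart_dom[OF chart_at(1)] order.refl smooth_on_const])
  from smooth_field_on_0[OF open_chart_dom[OF chart_at(1)] this]
  show "\<exists>W. open W \<and> x \<in> W \<and> smooth_field_on A W (\<lambda>x. 0)"
    using chart_at open_chart_dom by blast
qed

lemma lie_bracket_0_right:
  assumes "open U" "x \<in> U" "smooth_field_on A U X"
  shows "lie_bracket A X (\<lambda>x. 0) x = 0"
proof -
  let ?c = "chart_at A x"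
  let ?S = "chart_map ?c ` (U \<inter> chart_dom ?c)"
  have S: "open ?S" using assms by (intro open_chart_image open_Int open_chart_dom chart_at) auto
  have x: "coord_at A x \<in> ?S" using assms chart_at by (auto simp: coord_at_def)
  have "frechet_derivative (field_coords A ?c (\<lambda>x. 0)) (at (coord_at A x)) =
      frechet_derivative (\<lambda>z. 0) (at (coord_at A x))"
    by (rule frechet_derivative_cong_open[OF S x])
      (auto simp: field_coords_map chart_at linear_0[OF linear_tangent_coords])
  moreover have "field_coords A ?c X differentiable at (coord_at A x)"
    by (rule smooth_on_differentiable[OF smooth_field_on_coords[OF assms(3) chart_at(1) order.refl] x])
  ultimately show ?thesis
    unfolding lie_bracket_eq by (simp add: linear_0[OF linear_frechet_derivative])
qed

end

locale two_plectic_submersion = submersion A B p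
  for A :: "('m::{t2_space, second_countable_topology}, 'e::real_inner) atlas"
    and B :: "('b::{t2_space, second_countable_topology}, 'f::real_inner) atlas"
    and p :: "'m \<Rightarrow> 'b" +
  fixes \<Phi> :: "'m \<Rightarrow> 'e \<Rightarrow> 'e \<Rightarrow> 'e \<Rightarrow> real"
  assumes form3_\<Phi>: "form3 A TM \<Phi>" and closed_\<Phi>: "closed3 A TM \<Phi>"
    and fibres_\<Phi>: "fibres_2plectically A B p \<Phi>"
begin

section \<open>Pointwise consequences of the two conditions\<close>

lemma alt3_\<Phi>: "alt3 UNIV (\<Phi> x)"
  using form3_\<Phi> by (auto simp: form3_def)

lemmas \<Phi>_simps = alt3_simps[OF alt3_\<Phi>]

lemma smooth_\<Phi>:
  assumes "open U" "smooth_field_on A U X" "smooth_field_on A U Y" "smooth_field_on A U Z"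
  shows "smooth_fun_on A U (\<lambda>x. \<Phi> x (X x) (Y x) (Z x))"
  using form3_\<Phi> assms by (simp add: form3_def section_on_def)

lemma \<Phi>_nondegenerate:
  assumes X: "X \<in> V x" and 0: "\<And>Y Z. Y \<in> V x \<Longrightarrow> Z \<in> V x \<Longrightarrow> \<Phi> x X Y Z = 0"
  shows "X = 0"
proof -
  have a: "alt2 UNIV (\<lambda>Y Z. \<Phi> x X Y Z)" using alt3_\<Phi>[of x] by (auto simp: alt3_def)
  have "b (\<lambda>Y Z. \<Phi> x X Y Z) = 0" if "b \<in> ext_square (V x)" for b
    using that 0 by (auto simp: ext_square_def wedge_def a intro!: sum.neutral)
  then have "contract1 X (\<Phi> x) \<in> annihilator2 (ext_square (V x))"
    using a by (simp add: annihilator2_def contract1_def)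
  then have "(X, contract1 X (\<Phi> x)) \<in> {(X, contract1 X (\<Phi> x)) | X. X \<in> UNIV} \<inter>
      (V x \<times> annihilator2 (ext_square (V x)))"
    using X by auto
  also have "\<dots> = {(0, \<lambda>_ _. 0)}" using fibres_\<Phi> by (simp add: fibres_2plectically_def Let_def)
  finally show ?thesis by simp
qed

text \<open>Membership in \<open>annihilator\<close> demands linearity on all tangent vectors; it is
  read off after writing \<open>b\<close> as a finite sum of wedges.\<close>

lemma bivector_eq_0:
  assumes b: "b \<in> ext_square (V x)" and 0: "\<And>Z. Z \<in> V x \<Longrightarrow> contract2 b (\<Phi> x) Z = 0"
  shows "b = (\<lambda>_. 0)"
proof -
  obtain n X Y where n: "b = (\<lambda>\<eta>. \<Sum>i<(n::nat). wedge (X i) (Y i) \<eta>)"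
    using b by (auto simp: ext_square_def)
  have "contract2 b (\<Phi> x) = (\<lambda>Z. \<Sum>i<n. \<Phi> x (X i) (Y i) Z)"
    unfolding contract2_def n wedge_def by (simp add: alt3_slot3[OF alt3_\<Phi>])
  then have "alt1 UNIV (contract2 b (\<Phi> x))"
    by (simp add: alt1_def \<Phi>_simps sum.distrib sum_distrib_left)
  then have "contract2 b (\<Phi> x) \<in> annihilator (V x)" using 0 by (simp add: annihilator_def)
  moreover have "b \<in> ext_square UNIV" using b by (auto simp: ext_square_def)
  ultimately have "(b, contract2 b (\<Phi> x)) \<in> {(b, contract2 b (\<Phi> x)) | b. b \<in> ext_square UNIV} \<inter>
      (ext_square (V x) \<times> annihilator (V x))"
    using b by auto
  also have "\<dots> = {(\<lambda>_. 0, \<lambda>_. 0)}" using fibres_\<Phi> by (simp add: fibres_2plectically_def Let_def)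
  finally show ?thesis by simp
qed

lemma finite_spanning_set: "\<exists>S::'e set. finite S \<and> span S = UNIV"
  using M.orthonormal_basis_exists by (auto simp: orthonormal_basis_def)

lemma vertical_subset_span:
  assumes "F1 \<in> V x" "F2 \<in> V x" "F3 \<in> V x" "\<Phi> x F1 F2 F3 \<noteq> 0"
  shows "V x \<subseteq> span {F1, F2, F3}"
proof (rule subset_span_of_alt3_neq_0[OF alt3_\<Phi> _ assms])
  obtain S :: "'e set" where S: "finite S" "span S = UNIV" using finite_spanning_set by blast
  show "card C \<le> 3" if "independent C" "C \<subseteq> V x" for C
    by (rule card_independent_le_3[OF alt3_\<Phi> S subspace_V bivector_eq_0 that])
qed

text \<open>Nondegeneracy completes any nonzero vertical vector to a triple on which \<Phi> does not
  vanish.\<close>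

lemma vertical_cases:
  obtains "V x = {0}" | F1 F2 F3 where "F1 \<in> V x" "F2 \<in> V x" "F3 \<in> V x" "\<Phi> x F1 F2 F3 \<noteq> 0"
  using \<Phi>_nondegenerate[of _ x] subspace_0[OF subspace_V[of x]] by blast

text \<open>All tangent spaces share one model space, and so do the images. If \<open>T x\<close> is
  bijective, its inverse after \<open>T y\<close> is a surjective endomorphism, hence injective.
  This makes the zero field a valid vertical part on a whole neighbourhood.\<close>

lemma vertical_trivial:
  assumes "V x = {0}" shows "V y = {0}"
proof -
  obtain S :: "'e set" where S: "finite S" "span S = UNIV" using finite_spanning_set by blast
  have inj: "inj (T x)" unfolding linear_inj_iff_eq_0[OF linear_T]
    using assms by (auto simp: vertical_def)
  obtain g where g: "linear g" "T x \<circ> g = id"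
    using linear_surjective_right_inverse[OF linear_T surj_p] by blast
  have Tg: "T x (g w) = w" for w using g(2) by (metis comp_apply id_apply)
  have gT: "g (T x v) = v" for v by (metis Tg inj injD)
  have "surj (\<lambda>v. g (T y v))" by (metis gT surjD surjI surj_p surj_def)
  moreover have "linear (\<lambda>v. g (T y v))"
    using linear_compose[OF linear_T g(1)] by (simp add: o_def)
  ultimately have "inj (\<lambda>v. g (T y v))" by (intro linear_surj_imp_inj_finite_span[OF S])
  then have "inj (T y)" by (auto simp: inj_def)
  then show ?thesis unfolding linear_inj_iff_eq_0[OF linear_T]
    using linear_0[OF linear_T[of y]] by (auto simp: vertical_def)
qed

section \<open>The horizontal complement and its smoothness\<close>

definition Hor :: "'m \<Rightarrow> 'e set" where
  "Hor x = {w. \<forall>Y\<in>V x. \<forall>Z\<in>V x. \<Phi> x w Y Z = 0}"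

lemma Hor_\<Phi>:
  assumes "w \<in> Hor x" "Y \<in> V x" "Z \<in> V x"
  shows "\<Phi> x w Y Z = 0" "\<Phi> x Y w Z = 0" "\<Phi> x Y Z w = 0"
  using assms alt3_swap(1)[OF alt3_\<Phi>, of x Y w Z] alt3_swap(2)[OF alt3_\<Phi>, of x Y Z w]
  by (auto simp: Hor_def)

lemma subspace_Hor: "subspace (Hor x)"
  by (auto simp: subspace_def Hor_def \<Phi>_simps)

lemma vertical_Int_Hor: "V x \<inter> Hor x = {0}"
  using \<Phi>_nondegenerate[of _ x] subspace_0[OF subspace_V[of x]] subspace_0[OF subspace_Hor[of x]]
  by (auto simp: Hor_def)

lemma Hor_cramer:
  assumes "F1 \<in> V x" "F2 \<in> V x" "F3 \<in> V x" "\<Phi> x F1 F2 F3 \<noteq> 0"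
  defines "v \<equiv> \<lambda>w. (\<Phi> x w F2 F3 / \<Phi> x F1 F2 F3) *\<^sub>R F1 + (\<Phi> x F1 w F3 / \<Phi> x F1 F2 F3) *\<^sub>R F2 +
    (\<Phi> x F1 F2 w / \<Phi> x F1 F2 F3) *\<^sub>R F3"
  shows "v w \<in> V x" "w - v w \<in> Hor x"
proof -
  show "v w \<in> V x" unfolding v_def using assms
    by (intro subspace_add[OF subspace_V] subspace_scale[OF subspace_V])
  show "w - v w \<in> Hor x" unfolding v_def Hor_def
    using contraction_cramer[OF alt3_\<Phi> assms(4)] vertical_subset_span[OF assms(1-4)] by blast
qed

lemma vertical_Hor_decomposition: "\<exists>v\<in>V x. w - v \<in> Hor x"
proof (cases rule: vertical_cases[of x])
  case 1
  then show ?thesis by (intro bexI[of _ 0]) (auto simp: Hor_def \<Phi>_simps)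
next
  case (2 F1 F2 F3)
  show ?thesis using Hor_cramer[OF 2, of w] by blast
qed

text \<open>The triple at \<open>x0\<close> is extended to vertical fields. Where \<Phi> remains
  nonzero on them they still span, and the Cramer quotients are smooth.\<close>

lemma local_horizontal_part:
  assumes W: "open W" "x0 \<in> W" "smooth_field_on A W w"
  shows "\<exists>U v. open U \<and> x0 \<in> U \<and> U \<subseteq> W \<and> smooth_field_on A U v \<and> (\<forall>x\<in>U. v x \<in> V x \<and> w x - v x \<in> Hor x)"
proof (cases rule: vertical_cases[of x0])
  case 1
  have "0 \<in> V x \<and> w x - 0 \<in> Hor x" for x
    using vertical_trivial[OF 1, of x] by (auto simp: Hor_def \<Phi>_simps)
  then show ?thesis using W M.smooth_field_on_0[OF W(1,3)]
    by (intro exI[of _ W] exI[of _ "\<lambda>x. 0"]) auto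
next
  case (2 F1 F2 F3)
  obtain W1 X1 where a1: "open W1" "x0 \<in> W1" "section_on A V W1 X1" "X1 x0 = F1"
    using local_vertical_extension[OF 2(1)] by blast
  obtain W2 X2 where a2: "open W2" "x0 \<in> W2" "section_on A V W2 X2" "X2 x0 = F2"
    using local_vertical_extension[OF 2(2)] by blast
  obtain W3 X3 where a3: "open W3" "x0 \<in> W3" "section_on A V W3 X3" "X3 x0 = F3"
    using local_vertical_extension[OF 2(3)] by blast
  let ?W = "W \<inter> W1 \<inter> W2 \<inter> W3"
  let ?d = "\<lambda>x. \<Phi> x (X1 x) (X2 x) (X3 x)"
  have o: "open ?W" using W a1 a2 a3 by auto
  have "smooth_field_on A W1 X1" "smooth_field_on A W2 X2" "smooth_field_on A W3 X3"
    using a1 a2 a3 by (auto simp: section_on_def)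
  then have s: "smooth_field_on A ?W X1" "smooth_field_on A ?W X2" "smooth_field_on A ?W X3"
      "smooth_field_on A ?W w"
    using W(3) by (auto elim: M.smooth_field_on_mono)
  have "x0 \<in> ?W" "?d x0 \<noteq> 0" using W a1 a2 a3 2(4) by auto
  then obtain U where U: "open U" "x0 \<in> U" "U \<subseteq> ?W" "\<And>x. x \<in> U \<Longrightarrow> ?d x \<noteq> 0"
    using M.smooth_fun_on_neq_0_open[OF o smooth_\<Phi>[OF o s(1-3)], of x0] by blast
  note sU = s[THEN M.smooth_field_on_mono, OF U(3)]
  let ?v = "\<lambda>x. (\<Phi> x (w x) (X2 x) (X3 x) / ?d x) *\<^sub>R X1 x + (\<Phi> x (X1 x) (w x) (X3 x) / ?d x) *\<^sub>R X2 x +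
    (\<Phi> x (X1 x) (X2 x) (w x) / ?d x) *\<^sub>R X3 x"
  have "smooth_field_on A U ?v"
    by (intro M.smooth_field_on_add M.smooth_field_on_scaleR M.smooth_fun_on_divide smooth_\<Phi> U(1,4) sU)
  moreover have "?v x \<in> V x \<and> w x - ?v x \<in> Hor x" if "x \<in> U" for x
  proof -
    have x: "X1 x \<in> V x" "X2 x \<in> V x" "X3 x \<in> V x" "?d x \<noteq> 0"
      using a1 a2 a3 U that by (auto simp: section_on_def)
    show ?thesis using Hor_cramer[OF x, of "w x"] by blast
  qed
  ultimately show ?thesis using U by (intro exI[of _ U] exI[of _ ?v]) auto
qed

text \<open>The horizontal lift of a single tangent vector, where \<open>hor_lift\<close> takes a
  field. Linearity in \<open>a\<close> can be stated for it, and so can a form on the base at one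
  point.\<close>

definition lift :: "'m \<Rightarrow> 'f \<Rightarrow> 'e" where
  "lift x a = (THE w. w \<in> Hor x \<and> T x w = a)"

lemma lift_unique:
  assumes "w \<in> Hor x" "w' \<in> Hor x" "T x w = T x w'" shows "w = w'"
proof -
  have "w - w' \<in> V x \<inter> Hor x"
    using assms subspace_diff[OF subspace_Hor] by (simp add: vertical_def linear_diff[OF linear_T])
  then show ?thesis using vertical_Int_Hor by auto
qed

lemma lift: "lift x a \<in> Hor x" "T x (lift x a) = a"
proof -
  obtain w where w: "T x w = a" using surj_p by (metis surjD)
  obtain v where v: "v \<in> V x" "w - v \<in> Hor x" using vertical_Hor_decomposition by blast
  have "T x (w - v) = a" using v w by (simp add: linear_diff[OF linear_T] vertical_def)
  then have "\<exists>!w. w \<in> Hor x \<and> T x w = a" using v(2) lift_unique by blast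
  from theI'[OF this] show "lift x a \<in> Hor x" "T x (lift x a) = a" by (auto simp: lift_def)
qed

lemma lift_eqI: "w \<in> Hor x \<Longrightarrow> lift x (T x w) = w"
  using lift_unique lift by metis

lemma linear_lift: "linear (lift x)"
proof (rule linearI)
  show "lift x (a + b) = lift x a + lift x b" for a b
  proof (rule lift_unique[OF lift(1)])
    show "lift x a + lift x b \<in> Hor x" by (intro subspace_add[OF subspace_Hor] lift)
    show "T x (lift x (a + b)) = T x (lift x a + lift x b)" by (simp add: lift linear_add[OF linear_T])
  qed
  show "lift x (r *\<^sub>R a) = r *\<^sub>R lift x a" for r a
  proof (rule lift_unique[OF lift(1)])
    show "r *\<^sub>R lift x a \<in> Hor x" by (intro subspace_scale[OF subspace_Hor] lift)
    show "T x (lift x (r *\<^sub>R a)) = T x (r *\<^sub>R lift x a)" by (simp add: lift linear_scale[OF linear_T])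
  qed
qed

lemma hor_lift_eq: "hor_lift A B p Hor u x = lift x (u (p x))"
  by (simp add: hor_lift_def lift_def)

text \<open>Any smooth local lift minus its smooth vertical part is horizontal with the right
  projection, so uniqueness identifies it with \<open>lift\<close>. Fields on an open
  \<open>N\<close> are allowed because local frames and the smoothness of forms on the base need
  them.\<close>

lemma smooth_lift:
  assumes "open U" "open N" "p ` U \<subseteq> N" "smooth_field_on B N u"
  shows "smooth_field_on A U (\<lambda>x. lift x (u (p x)))"
proof (rule M.smooth_field_on_local)
  fix x0 assume "x0 \<in> U"
  then have "p x0 \<in> N" using assms by auto
  from local_lift[OF assms(2,4) this]
  obtain W w where W: "open W" "x0 \<in> W" "p ` W \<subseteq> N" "smooth_field_on A W w" "\<And>y. y \<in> W \<Longrightarrow>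
      T y (w y) = u (p y)"
    by blast
  from local_horizontal_part[OF W(1,2,4)]
  obtain S v where S: "open S" "x0 \<in> S" "S \<subseteq> W" "smooth_field_on A S v"
    "\<And>x. x \<in> S \<Longrightarrow> v x \<in> V x" "\<And>x. x \<in> S \<Longrightarrow> w x - v x \<in> Hor x" by blast
  have "smooth_field_on A S (\<lambda>x. w x - v x)"
    by (rule M.smooth_field_on_diff[OF S(1) M.smooth_field_on_mono[OF W(4) S(3)] S(4)])
  then have "smooth_field_on A S (\<lambda>x. lift x (u (p x)))"
  proof (rule M.smooth_field_on_cong[OF S(1)])
    fix x assume x: "x \<in> S"
    have "T x (w x - v x) = u (p x)"
      using S(3,5) W(5) x by (auto simp: linear_diff[OF linear_T] vertical_def)
    then show "w x - v x = lift x (u (p x))" using lift_eqI[OF S(6)[OF x]] by simp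
  qed
  then show "\<exists>W. open W \<and> x0 \<in> W \<and> smooth_field_on A W (\<lambda>x. lift x (u (p x)))" using S by blast
qed

text \<open>A local frame is obtained by lifting the coordinate frame of a chart of the
  base.\<close>

lemma subbundle_Hor: "subbundle A Hor"
  unfolding subbundle_def
proof
  fix x
  obtain F :: "'f set" where F: "orthonormal_basis F" using N.orthonormal_basis_exists by blast
  have F': "finite F" "span F = UNIV" "\<And>a b. a \<in> F \<Longrightarrow> b \<in> F \<Longrightarrow> a \<bullet> b = (if a = b then 1 else 0)"
    using F by (auto simp: orthonormal_basis_def)
  have "0 \<notin> F" using F'(3)[of 0 0] by auto
  moreover have "pairwise orthogonal F" using F'(3) by (simp add: pairwise_def orthogonal_def)
  ultimately have iF: "independent F" by (intro pairwise_orthogonal_independent)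
  obtain e where e: "bij_betw e {..<card F} F"
    using ex_bij_betw_nat_finite[OF F'(1)] by (auto simp: atLeast0LessThan)
  let ?d = "chart_at B (p x)"
  \<comment> \<open>In a fixed base chart, \<open>K y\<close> is an isomorphism from the model space
    of the base onto \<open>Hor y\<close>, so it carries the basis \<open>F\<close> to a
    basis.\<close>
  define K where "K = (\<lambda>y a. lift y (N.of_coords ?d (p y) a))"
  let ?U = "p -` chart_dom ?d"
  have U: "open ?U" by (intro open_vimage_p N.open_chart_dom N.chart_at)
  have sK: "smooth_field_on A ?U (\<lambda>y. K y a)" for a
  proof -
    have "smooth_field_on B (chart_dom ?d) (\<lambda>b. N.of_coords ?d b ((\<lambda>_. a) (chart_map ?d b)))"
      by (rule N.smooth_field_on_of_coords[OF N.chart_at(1) N.open_chart_dom[OF N.chart_at(1)] order.refl smooth_on_const])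
    then show ?thesis unfolding K_def
      by (intro smooth_lift[OF U N.open_chart_dom[OF N.chart_at(1)], of _ "\<lambda>b. N.of_coords ?d b a"]) auto
  qed
  have frame: "inj_on (\<lambda>i. K y (e i)) {..<card F} \<and> independent ((\<lambda>i. K y (e i)) ` {..<card F}) \<and>
      span ((\<lambda>i. K y (e i)) ` {..<card F}) = Hor y" if "y \<in> ?U" for y
  proof -
    have y: "p y \<in> chart_dom ?d" using that by simp
    have lo: "linear (N.of_coords ?d (p y))" unfolding N.of_coords_def
      by (intro linear_frechet_derivative N.transition_differentiable N.chart_at y)
    have lK: "linear (K y)" unfolding K_def using linear_compose[OF lo linear_lift] by (simp add: o_def)
    have inv: "tangent_coords B ?d (p y) (T y (K y a)) = a" for a
      unfolding K_def lift(2) by (rule N.tangent_coords_of_coords[OF N.chart_at(1) y])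
    have iK: "inj (K y)" by (metis inv injI)
    have "w \<in> range (K y)" if "w \<in> Hor y" for w
    proof -
      have "K y (tangent_coords B ?d (p y) (T y w)) = w"
        unfolding K_def N.of_coords_tangent_coords[OF N.chart_at(1) y] by (rule lift_eqI[OF that])
      then show ?thesis by (metis rangeI)
    qed
    moreover have "K y a \<in> Hor y" for a unfolding K_def by (rule lift(1))
    ultimately have rK: "range (K y) = Hor y" by blast
    have im: "(\<lambda>i. K y (e i)) ` {..<card F} = K y ` F"
      using e by (auto simp: bij_betw_def image_image[symmetric])
    have "inj_on (\<lambda>i. K y (e i)) {..<card F}"
      using e iK by (auto simp: bij_betw_def inj_on_def)
    moreover have "independent (K y ` F)"
      by (rule linear_independent_injective_image[OF lK iF]) (rule inj_on_subset[OF iK], simp)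
    moreover have "span (K y ` F) = Hor y" using linear_span_image[OF lK, of F] F'(2) rK by simp
    ultimately show ?thesis unfolding im by blast
  qed
  show "\<exists>U (k::nat) G. open U \<and> x \<in> U \<and> (\<forall>i<k. smooth_field_on A U (G i)) \<and>
      (\<forall>y\<in>U. inj_on (\<lambda>i. G i y) {..<k} \<and> independent ((\<lambda>i. G i y) ` {..<k}) \<and>
        span ((\<lambda>i. G i y) ` {..<k}) = Hor y)"
    by (rule exI[of _ ?U], rule exI[of _ "card F"], rule exI[of _ "\<lambda>i y. K y (e i)"])
      (use U sK frame N.chart_at in auto)
qed

lemma ehresmann_Hor: "ehresmann_connection A B p Hor"
  unfolding ehresmann_connection_def
proof (intro conjI allI subbundle_Hor vertical_Int_Hor)
  fix x
  have "w \<in> {v + w |v w. v \<in> V x \<and> w \<in> Hor x}" for w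
  proof -
    obtain v where "v \<in> V x" "w - v \<in> Hor x" using vertical_Hor_decomposition by blast
    then show ?thesis by (intro CollectI exI[of _ v] exI[of _ "w - v"]) auto
  qed
  then show "{v + w |v w. v \<in> V x \<and> w \<in> Hor x} = UNIV" by blast
qed

section \<open>Vertical closedness, compatibility of the connection, and its curvature\<close>

abbreviation \<Phi>V where "\<Phi>V \<equiv> vertical_component A B p \<Phi>"

lemma \<Phi>V_eq: "X \<in> V x \<Longrightarrow> Y \<in> V x \<Longrightarrow> Z \<in> V x \<Longrightarrow> \<Phi>V x X Y Z = \<Phi> x X Y Z"
  by (simp add: vertical_component_def)

text \<open>A vertical field is related to the zero field, so its bracket with a field related to
  \<open>u\<close> is related to the bracket of \<open>u\<close> with 0.\<close>

lemma lie_bracket_vertical: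
  assumes "open U" "x \<in> U" "smooth_field_on A U X" "section_on A V U Y"
    "open W" "smooth_field_on B W u" "p ` U \<subseteq> W" "\<And>y. y \<in> U \<Longrightarrow> T y (X y) = u (p y)"
  shows "lie_bracket A X Y x \<in> V x"
proof -
  have "T x (lie_bracket A X Y x) = lie_bracket B u (\<lambda>b. 0) (p x)"
    using assms N.smooth_field_on_0[OF assms(5,6)]
    by (intro T_bracket[where U = U and W = W]) (auto simp: section_on_def vertical_def)
  also have "\<dots> = 0" using assms by (intro N.lie_bracket_0_right[OF assms(5) _ assms(6)]) auto
  finally show ?thesis by (simp add: vertical_def)
qed

lemma lie_bracket_vertical_vertical:
  assumes "open U" "x \<in> U" "section_on A V U X" "section_on A V U Y"
  shows "lie_bracket A X Y x \<in> V x"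
  by (rule lie_bracket_vertical[OF assms(1,2) _ assms(4) open_UNIV N.smooth_field_on_0_UNIV])
    (use assms in \<open>auto simp: section_on_def vertical_def\<close>)

lemma lie_bracket_lift_vertical:
  assumes "open U" "x \<in> U" "smooth_field_on B UNIV u" "section_on A V U Y"
  shows "lie_bracket A (\<lambda>x. lift x (u (p x))) Y x \<in> V x"
  by (rule lie_bracket_vertical[OF assms(1,2) smooth_lift[OF assms(1) open_UNIV _ assms(3)] assms(4) open_UNIV assms(3)])
    (auto simp: lift)

lemma closed:
  assumes "open U" "x \<in> U" "smooth_field_on A U W" "smooth_field_on A U X" "smooth_field_on A U Y"
      "smooth_field_on A U Z"
  shows "ext_d3 A \<Phi> W X Y Z x = 0"
  using closed_\<Phi> assms by (auto simp: closed3_def section_on_def)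

text \<open>Closedness descends because vertical fields are closed under brackets: the Koszul
  formula for \<open>\<Phi>V\<close> agrees with that for \<Phi> term by term.\<close>

lemma two_plectic_fibres:
  assumes "fibration A B p" shows "fibration_2plectic_fibres A B p \<Phi>V"
  unfolding fibration_2plectic_fibres_def
proof (intro conjI assms)
  show "form3 A V \<Phi>V"
    unfolding form3_def
  proof (intro conjI allI impI)
    fix x
    show "alt3 (V x) (\<Phi>V x)"
      using subspace_add[OF subspace_V[of x]] subspace_scale[OF subspace_V[of x]]
      by (auto simp: alt3_def alt2_def alt1_def \<Phi>V_eq \<Phi>_simps)
  next
    fix U X Y Z
    assume *: "open U \<and> section_on A V U X \<and> section_on A V U Y \<and> section_on A V U Z"
    then have "smooth_fun_on A U (\<lambda>x. \<Phi> x (X x) (Y x) (Z x))"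
      by (intro smooth_\<Phi>) (auto simp: section_on_def)
    then show "smooth_fun_on A U (\<lambda>x. \<Phi>V x (X x) (Y x) (Z x))"
      by (rule M.smooth_fun_on_cong[rotated]) (use * in \<open>auto simp: section_on_def \<Phi>V_eq\<close>)
  qed
  show "closed3 A V \<Phi>V"
    unfolding closed3_def
  proof (intro allI impI ballI)
    fix U W X Y Z x
    assume *: "open U \<and> section_on A V U W \<and> section_on A V U X \<and> section_on A V U Y \<and> section_on A V U Z"
      and x: "x \<in> U"
    then have s: "open U" "section_on A V U W" "section_on A V U X" "section_on A V U Y"
        "section_on A V U Z" by auto
    have dd: "dir_deriv A S (\<lambda>y. \<Phi>V y (P y) (Q y) (R y)) x = dir_deriv A S (\<lambda>y. \<Phi> y (P y) (Q y) (R y)) x"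
      if "section_on A V U P" "section_on A V U Q" "section_on A V U R" for S P Q R
      by (rule M.dir_deriv_cong[OF s(1) x]) (use that in \<open>auto simp: section_on_def \<Phi>V_eq\<close>)
    have vv: "W x \<in> V x" "X x \<in> V x" "Y x \<in> V x" "Z x \<in> V x" using s x by (auto simp: section_on_def)
    have "ext_d3 A \<Phi>V W X Y Z x = ext_d3 A \<Phi> W X Y Z x"
      unfolding ext_d3_def
      by (simp add: dd s vv \<Phi>V_eq lie_bracket_vertical_vertical[OF s(1) x])
    also have "\<dots> = 0" using s x by (intro closed[OF s(1)]) (auto simp: section_on_def)
    finally show "ext_d3 A \<Phi>V W X Y Z x = 0" .
  qed
  show "\<forall>x. \<forall>X\<in>V x. (\<forall>Y\<in>V x. \<forall>Z\<in>V x. \<Phi>V x X Y Z = 0) \<longrightarrow> X = 0"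
    using \<Phi>_nondegenerate by (auto simp: \<Phi>V_eq)
qed

lemma connection_2plectic_Hor: "connection_2plectic A B p \<Phi>V Hor"
  unfolding connection_2plectic_def
proof (intro conjI ehresmann_Hor allI impI ballI)
  fix u U X Y Z x
  assume u: "smooth_field_on B UNIV u"
    and "open U \<and> section_on A V U X \<and> section_on A V U Y \<and> section_on A V U Z" and x: "x \<in> U"
  then have s: "open U" "section_on A V U X" "section_on A V U Y" "section_on A V U Z" by auto
  define h where "h = (\<lambda>x. lift x (u (p x)))"
  have hl: "hor_lift A B p Hor u = h" by (simp add: fun_eq_iff hor_lift_eq h_def)
  have hH: "h y \<in> Hor y" for y by (simp add: h_def lift)
  have h: "smooth_field_on A U h" unfolding h_def by (rule smooth_lift[OF s(1) open_UNIV _ u]) auto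
  note bh = lie_bracket_lift_vertical[OF s(1) x u, folded h_def]
  note bv = lie_bracket_vertical_vertical[OF s(1) x]
  have vv: "X x \<in> V x" "Y x \<in> V x" "Z x \<in> V x" using s x by (auto simp: section_on_def)
  \<comment> \<open>The differentiated function vanishes identically on \<open>U\<close>, so its
    derivative is 0 along any field.\<close>
  have 0: "dir_deriv A S (\<lambda>y. \<Phi> y (h y) (P y) (Q y)) x = 0"
    if "section_on A V U P" "section_on A V U Q" for S P Q
  proof -
    have "dir_deriv A S (\<lambda>y. \<Phi> y (h y) (P y) (Q y)) x = dir_deriv A S (\<lambda>y. 0) x"
      by (rule M.dir_deriv_cong[OF s(1) x]) (use that Hor_\<Phi>(1)[OF hH] in \<open>auto simp: section_on_def\<close>)
    then show ?thesis by (simp add: M.dir_deriv_const)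
  qed
  have dd: "dir_deriv A h (\<lambda>y. \<Phi>V y (X y) (Y y) (Z y)) x = dir_deriv A h (\<lambda>y. \<Phi> y (X y) (Y y) (Z y)) x"
    by (rule M.dir_deriv_cong[OF s(1) x]) (use s in \<open>auto simp: section_on_def \<Phi>V_eq\<close>)
  have "ext_d3 A \<Phi> h X Y Z x = 0"
    using s x h by (intro closed[OF s(1)]) (auto simp: section_on_def)
  \<comment> \<open>Four of the ten Koszul terms remain. In each of the others \<open>h\<close>
    stands with two vertical arguments, a bracket of vertical fields being one of them or the
    function being differentiated.\<close>
  then have "dir_deriv A h (\<lambda>y. \<Phi> y (X y) (Y y) (Z y)) x
     - \<Phi> x (lie_bracket A h X x) (Y x) (Z x)
     + \<Phi> x (lie_bracket A h Y x) (X x) (Z x)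
     - \<Phi> x (lie_bracket A h Z x) (X x) (Y x) = 0"
    unfolding ext_d3_def by (simp add: 0 s Hor_\<Phi>[OF hH] bv vv)
  \<comment> \<open>Moving each bracket back to the slot of its field turns the alternating signs of
    the Koszul formula into those of the Lie derivative.\<close>
  moreover have "\<Phi> x (lie_bracket A h Y x) (X x) (Z x) = - \<Phi> x (X x) (lie_bracket A h Y x) (Z x)"
    by (rule alt3_swap(1)[OF alt3_\<Phi>])
  moreover have "\<Phi> x (lie_bracket A h Z x) (X x) (Y x) = \<Phi> x (X x) (Y x) (lie_bracket A h Z x)"
    using alt3_swap(1)[OF alt3_\<Phi>, of x "lie_bracket A h Z x" "X x" "Y x"]
      alt3_swap(2)[OF alt3_\<Phi>, of x "X x" "lie_bracket A h Z x" "Y x"] by simp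
  ultimately show "lie_deriv3 A (hor_lift A B p Hor u) \<Phi>V X Y Z x = 0"
    unfolding hl lie_deriv3_def dd by (simp add: \<Phi>V_eq vv bh s)
qed

lemma hamiltonian_curvature_Hor: "hamiltonian_curvature A B p \<Phi>V Hor"
  unfolding hamiltonian_curvature_def
proof (intro exI conjI allI impI ballI)
  \<comment> \<open>The sign is fixed by the convention that minus the contraction with the
    curvature is the differential. Pointwise lifts make the value depend only on the two vectors at
    \<open>p x\<close>, as a 2-form on the base must.\<close>
  let ?\<omega> = "\<lambda>x a b w. - \<Phi> x (lift x a) (lift x b) w"
  note ls = linear_add[OF linear_lift] linear_scale[OF linear_lift]
  show "base_form2_vertical_form1 A B p ?\<omega>"
    unfolding base_form2_vertical_form1_def
  proof (intro conjI allI ballI impI)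
    show "alt2 UNIV (\<lambda>u v. ?\<omega> x u v w)" for x w
      by (simp add: alt2_def alt1_def ls \<Phi>_simps)
    show "alt1 (V x) (?\<omega> x u v)" for x u v
      by (simp add: alt1_def \<Phi>_simps)
  next
    fix N u v U Y
    assume "open N \<and> smooth_field_on B N u \<and> smooth_field_on B N v"
      and "open U \<and> p ` U \<subseteq> N \<and> section_on A V U Y"
    then show "smooth_fun_on A U (\<lambda>x. ?\<omega> x (u (p x)) (v (p x)) (Y x))"
      by (intro M.smooth_fun_on_minus smooth_\<Phi> smooth_lift[where N = N]) (auto simp: section_on_def)
  qed
  fix u v U Y Z x
  assume "smooth_field_on B UNIV u \<and> smooth_field_on B UNIV v"
    and "open U \<and> section_on A V U Y \<and> section_on A V U Z" and x: "x \<in> U"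
  then have u: "smooth_field_on B UNIV u" and v: "smooth_field_on B UNIV v"
    and s: "open U" "section_on A V U Y" "section_on A V U Z" by auto
  define h where "h = (\<lambda>x. lift x (u (p x)))"
  define k where "k = (\<lambda>x. lift x (v (p x)))"
  have hl: "hor_lift A B p Hor u = h" "hor_lift A B p Hor v = k"
    by (simp_all add: fun_eq_iff hor_lift_eq h_def k_def)
  have hH: "h y \<in> Hor y" "k y \<in> Hor y" for y by (simp_all add: h_def k_def lift)
  have h: "smooth_field_on A U h" unfolding h_def by (rule smooth_lift[OF s(1) open_UNIV _ u]) auto
  have k: "smooth_field_on A U k" unfolding k_def by (rule smooth_lift[OF s(1) open_UNIV _ v]) auto
  note bh = lie_bracket_lift_vertical[OF s(1) x u, folded h_def]
  note bk = lie_bracket_lift_vertical[OF s(1) x v, folded k_def]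
  note bv = lie_bracket_vertical_vertical[OF s(1) x]
  have vv: "Y x \<in> V x" "Z x \<in> V x" and sY: "smooth_field_on A U Y" and sZ: "smooth_field_on A U Z"
    using s x by (auto simp: section_on_def)
  define C where "C = curvature A B p Hor u v x"
  have C: "C = lie_bracket A h k x - lift x (lie_bracket B u v (p x))"
    by (simp add: C_def curvature_def hl) (simp add: hor_lift_eq)
  have "T x (lie_bracket A h k x) = lie_bracket B u v (p x)"
    by (rule T_bracket[OF s(1) h k x open_UNIV u v]) (auto simp: h_def k_def lift)
  \<comment> \<open>Both terms of \<open>C\<close> project to the same vector. Verticality also
    ensures that \<open>vertical_component\<close> gives the value of \<Phi> and not its default
    0.\<close>
  then have CV: "C \<in> V x" unfolding C vertical_def by (simp add: linear_diff[OF linear_T] lift)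
  have 0: "dir_deriv A S (\<lambda>y. \<Phi> y (l y) (Y y) (Z y)) x = 0" if "\<And>y. l y \<in> Hor y" for S l
  proof -
    have "dir_deriv A S (\<lambda>y. \<Phi> y (l y) (Y y) (Z y)) x = dir_deriv A S (\<lambda>y. 0) x"
      by (rule M.dir_deriv_cong[OF s(1) x]) (use s Hor_\<Phi>(1)[OF that] in \<open>auto simp: section_on_def\<close>)
    then show ?thesis by (simp add: M.dir_deriv_const)
  qed
  have "ext_d3 A \<Phi> h k Y Z x = 0" by (rule closed[OF s(1) x h k sY sZ])
  \<comment> \<open>The six vanishing terms have one horizontal and two vertical arguments; brackets
    of a lift with a vertical field count as vertical.\<close>
  then have d: "dir_deriv A Y (\<lambda>y. \<Phi> y (h y) (k y) (Z y)) x - dir_deriv A Z (\<lambda>y. \<Phi> y (h y) (k y) (Y y)) x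
      - \<Phi> x (lie_bracket A h k x) (Y x) (Z x) - \<Phi> x (lie_bracket A Y Z x) (h x) (k x) = 0"
    unfolding ext_d3_def by (simp add: 0[OF hH(1)] 0[OF hH(2)] s Hor_\<Phi>[OF hH(1)] Hor_\<Phi>[OF hH(2)] bh bk vv)
  \<comment> \<open>\<open>C\<close> differs from the bracket of the lifts by a horizontal vector,
    which \<Phi> annihilates against vertical pairs.\<close>
  have "\<Phi> x C (Y x) (Z x) = \<Phi> x (lie_bracket A h k x) (Y x) (Z x)"
    unfolding C by (simp add: \<Phi>_simps Hor_\<Phi>(1)[OF lift(1)] vv)
  moreover have "\<Phi> x (lie_bracket A Y Z x) (h x) (k x) = \<Phi> x (h x) (k x) (lie_bracket A Y Z x)"
    using alt3_swap(1)[OF alt3_\<Phi>, of x "lie_bracket A Y Z x" "h x" "k x"]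
      alt3_swap(2)[OF alt3_\<Phi>, of x "h x" "lie_bracket A Y Z x" "k x"] by simp
  moreover have "ext_d1 A (\<lambda>y. ?\<omega> y (u (p y)) (v (p y))) Y Z x =
      - dir_deriv A Y (\<lambda>y. \<Phi> y (h y) (k y) (Z y)) x + dir_deriv A Z (\<lambda>y. \<Phi> y (h y) (k y) (Y y)) x
      + \<Phi> x (h x) (k x) (lie_bracket A Y Z x)"
    unfolding ext_d1_def h_def[symmetric] k_def[symmetric]
    by (simp add: M.dir_deriv_minus[OF smooth_\<Phi>[OF s(1) h k sY] x] M.dir_deriv_minus[OF smooth_\<Phi>[OF s(1) h k sZ] x]
      fun_cong[OF h_def, symmetric] fun_cong[OF k_def, symmetric])
  ultimately show "- contract1 (curvature A B p Hor u v x) (\<Phi>V x) (Y x) (Z x) =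
      ext_d1 A (\<lambda>y. ?\<omega> y (u (p y)) (v (p y))) Y Z x"
    unfolding C_def[symmetric] contract1_def using d by (simp add: \<Phi>V_eq CV vv)
qed

end

theorem proposition10:
  fixes A :: "('m::{t2_space, second_countable_topology}, 'e::real_inner) atlas"
    and B :: "('b::{t2_space, second_countable_topology}, 'f::real_inner) atlas"
    and p :: "'m \<Rightarrow> 'b"
    and \<Phi> :: "'m \<Rightarrow> 'e \<Rightarrow> 'e \<Rightarrow> 'e \<Rightarrow> real"
  assumes "fibration A B p"
    and "form3 A TM \<Phi>"
    and "closed3 A TM \<Phi>"
    and "fibres_2plectically A B p \<Phi>"
  shows "fibration_2plectic_fibres A B p (vertical_component A B p \<Phi>) \<and>
    (\<exists>Hor. connection_2plectic A B p (vertical_component A B p \<Phi>) Hor \<and>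
           hamiltonian_curvature A B p (vertical_component A B p \<Phi>) Hor)"
proof -
  interpret two_plectic_submersion A B p \<Phi>
    using assms by unfold_locales (auto simp: fibration_def)
  show ?thesis
    using two_plectic_fibres[OF assms(1)] connection_2plectic_Hor hamiltonian_curvature_Hor by blast
qed

end
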